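(* Up to multiplication by a positive constant, there exists at most one non-trivial measure $\mu$ on the set of self-avoiding loops in the plane that satisfies weak conformal restriction. Furthermore, for any such $\mu$ there is a positive constant $c$ (depending on $\mu$ only) such that for any simply connected domains $\tilde D\subset D\subsetneq\mathbb{C}$ and any $z\in\tilde D$, $$\mu\big(\{\gamma : \gamma\subset D,\ \gamma\not\subset\tilde D,\ \gamma \text{ disconnects } z \text{ from } \partial D\}\big)=c\log\Phi'(z),$$ where $\Phi$ denotes the conformal map from $\tilde D$ onto $D$ such that $\Phi(z)=z$ and $\Phi'(z)$ is a positive real.
   Context: A self-avoiding loop in $\mathbb{C}$ is a continuous injective map from the unit circle into $\mathbb{C}$, modulo monotone reparametrization (only the trace matters; a single point is not a loop). An annular region is a bounded open set $A\subset\mathbb{C}$ conformally equivalent to some annulus $\{z : 1<|z|<R\}$; its hole is the bounded connected component of $\mathbb{C}\setminus A$. Let $\mathcal{U}_A$ be the set of self-avoiding loops contained in $A$ with non-zero index around the hole of $A$. Measures on self-avoiding loops are defined on the $\sigma$-field $\mathcal{G}$ generated by the sets $\mathcal{U}_A$, $A$ ranging over annular regions. Domains are open sets. For a simply connected domain $D$, $\mu_D=\mu 1_{\{\gamma\subset D\}}$ is $\mu$ restricted to loops that stay in $D$. For a conformal map $\Phi$ (holomorphic bijection) from $D$ onto $D'$, $\Phi\circ\mu_D$ is the push-forward of $\mu_D$ under $\gamma\mapsto\Phi(\gamma)$. The measure $\mu$ satisfies weak conformal restriction if for any two simply connected domains $D,D'\subset\mathbb{C}$ and any conformal map $\Phi$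 from $D$ onto $D'$, $\Phi\circ\mu_D=\mu_{D'}$. $\mu$ is non-trivial if for some $0<\delta<\Delta<\infty$, the mass of the set of loops of diameter at least $\delta$ that are contained in some disc of radius $\Delta$ is neither zero nor infinity. *)

theory Defs
  imports "HOL-Complex_Analysis.Complex_Analysis"
begin

definition conformal_map :: "(complex \<Rightarrow> complex) \<Rightarrow> complex set \<Rightarrow> complex set \<Rightarrow> bool" where
  "conformal_map \<Phi> D D' \<longleftrightarrow> \<Phi> holomorphic_on D \<and> bij_betw \<Phi> D D'"

definition simply_connected_domain :: "complex set \<Rightarrow> bool" where
  "simply_connected_domain D \<longleftrightarrow> open D \<and> simply_connected D"

text \<open>Two injective parametrizations of the circle agree up to monotone reparametrization of
  either direction iff they have the same trace, so a loop is represented by its trace.\<close>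

definition parametrizes :: "(complex \<Rightarrow> complex) \<Rightarrow> complex set \<Rightarrow> bool" where
  "parametrizes f \<gamma> \<longleftrightarrow>
     continuous_on (sphere 0 1) f \<and> inj_on f (sphere 0 1) \<and> f ` sphere 0 1 = \<gamma>"

definition self_avoiding_loops :: "complex set set" where
  "self_avoiding_loops = {\<gamma>. \<exists>f. parametrizes f \<gamma>}"

definition annular_region :: "complex set \<Rightarrow> bool" where
  "annular_region A \<longleftrightarrow> open A \<and> bounded A \<and>
     (\<exists>R>1. \<exists>f. conformal_map f {z. 1 < norm z \<and> norm z < R} A)"

definition hole :: "complex set \<Rightarrow> complex set" where
  "hole A = (THE K. K \<in> components (- A) \<and> bounded K)"

text \<open>Up to sign the index does not depend on the parametrization, so it is immaterial that one
  is chosen existentially.\<close>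

definition loops_around_hole :: "complex set \<Rightarrow> complex set set" where
  "loops_around_hole A = {\<gamma> \<in> self_avoiding_loops. \<gamma> \<subseteq> A \<and>
     (\<exists>f. parametrizes f \<gamma> \<and> (\<forall>z\<in>hole A. winding_number (f \<circ> circlepath 0 1) z \<noteq> 0))}"

definition loop_space :: "complex set measure" where
  "loop_space = sigma self_avoiding_loops {loops_around_hole A | A. annular_region A}"

definition loop_measure :: "complex set measure \<Rightarrow> bool" where
  "loop_measure \<mu> \<longleftrightarrow> sets \<mu> = sets loop_space"

definition restr_loops :: "complex set measure \<Rightarrow> complex set \<Rightarrow> complex set measure" where
  "restr_loops \<mu> D = restrict_space \<mu> {\<gamma>. \<gamma> \<subseteq> D}"

text \<open>The measure \<open>restr_loops \<mu> D\<close> lives on the loops in \<open>D\<close> only, since \<open>\<Phi>\<close> is arbitrary outside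
  \<open>D\<close>; accordingly the push-forward is taken on the space of loops in \<open>D'\<close>.\<close>

definition weak_conformal_restriction :: "complex set measure \<Rightarrow> bool" where
  "weak_conformal_restriction \<mu> \<longleftrightarrow>
     (\<forall>D D' \<Phi>. simply_connected_domain D \<and> simply_connected_domain D' \<and> conformal_map \<Phi> D D' \<longrightarrow>
        distr (restr_loops \<mu> D) (restr_loops \<mu> D') (\<lambda>\<gamma>. \<Phi> ` \<gamma>) = restr_loops \<mu> D')"

text \<open>The disc is fixed before the mass is taken: for a translation-invariant measure, the loops
  of diameter at least \<open>\<delta>\<close> contained in any one of the discs of radius \<open>\<Delta>\<close> together have mass zero
  or infinity.\<close>

definition nontrivial :: "complex set measure \<Rightarrow> bool" where
  "nontrivial \<mu> \<longleftrightarrow> (\<exists>\<delta> \<Delta> a. 0 < \<delta> \<and> \<delta> < \<Delta> \<and>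
     emeasure \<mu> {\<gamma> \<in> self_avoiding_loops. \<delta> \<le> diameter \<gamma> \<and> \<gamma> \<subseteq> ball a \<Delta>} \<notin> {0, \<infinity>})"

definition disconnects :: "complex set \<Rightarrow> complex \<Rightarrow> complex set \<Rightarrow> bool" where
  "disconnects \<gamma> z S \<longleftrightarrow> z \<notin> \<gamma> \<and> (\<forall>w\<in>S. \<not> connected_component (- \<gamma>) z w)"

end

theory Submission
  imports Defs
begin

text \<open>
  Write \<open>E D z\<close> (below: \<open>surrounding_loops D z\<close>) for the set of loops in \<open>D\<close> that have \<open>z\<close> in
  their bounded complementary component. The mass to be computed is that of \<open>E D z - E D' z\<close>.

  The formula rests on the observation that the asymptotics near \<open>z\<close> decide everything. For
  concentric discs of radii \<open>r \<le> s\<close>, scale invariance makes the mass of the difference a function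
  of \<open>s / r\<close>; it is monotone, it turns products into sums, and it is finite by non-triviality, since
  loops in such a difference have diameter at least \<open>r\<close>. Hence it is \<open>c * ln (s / r)\<close> (\<open>shell_mass\<close>), and \<open>c > 0\<close>
  because countably many such differences exhaust all loops. Now let \<open>g\<close> map the unit disc
  conformally onto \<open>D\<close>, with \<open>g 0 = z\<close>, and let \<open>\<rho>\<close> be the conformal radius \<open>norm (deriv g 0)\<close>.
  The image under \<open>g\<close> of the disc of radius \<open>t\<close> is, for small \<open>t\<close>, squeezed between round discs of
  radii close to \<open>\<rho> * t\<close>, while by conformal invariance \<open>D\<close> minus this image has mass exactly
  \<open>c * ln (1 / t)\<close>. So \<open>D\<close> minus a disc of radius \<open>s\<close> has mass \<open>c * ln (\<rho> / s)\<close> up to an error that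
  vanishes with \<open>s\<close>, and subtracting this for \<open>D'\<close> from this for \<open>D\<close> leaves \<open>c * ln (\<rho> / \<rho>')\<close>
  (\<open>emeasure_eq_ln_conformal_radius_ratio\<close>). The ratio \<open>\<rho> / \<rho>'\<close> is \<open>\<Phi>' z\<close>.

  Both the push-forward under a conformal map and the uniqueness need a handle on the sigma-field.
  It is generated by the events that a given point lies inside the loop (\<open>sets_loop_space\<close>): a
  Jordan curve is the common boundary of its inside and its outside, so which points of a countable
  dense set are inside decides whether the loop meets a given ball. Conformal maps of simply
  connected domains respect insides, hence act measurably.

  For uniqueness, the loops are covered by countably many shells
  \<open>E (ball z s) z - E (ball z r) z\<close> of finite mass. Inside a shell the events \<open>E V z\<close>, with \<open>V\<close>
  simply connected and \<open>z\<close> fixed, are closed under intersection, and the formula gives their masses.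
  They generate all events in the shell (\<open>trace_sigma_shell\<close>), because a point \<open>q\<close> is outside a
  loop around \<open>z\<close> if and only if the loop lies in one of countably many discs slit along a connected
  union of small discs leading from \<open>q\<close> to the boundary.
\<close>

section \<open>Self-avoiding loops and their interiors\<close>

definition surrounding_loops :: "complex set \<Rightarrow> complex \<Rightarrow> complex set set" where
  "surrounding_loops D z = {\<gamma> \<in> self_avoiding_loops. \<gamma> \<subseteq> D \<and> z \<in> inside \<gamma>}"

text \<open>Only countability and density matter; the choice is fixed once so that measurability proofs can
  quantify over it.\<close>

definition dense_points :: "complex set" where
  "dense_points = (SOME Q. countable Q \<and> (\<forall>X. open X \<and> X \<noteq> {} \<longrightarrow> (\<exists>q\<in>Q. q \<in> X)))"

lemma dense_points: "countable dense_points" "open X \<Longrightarrow> x \<in> X \<Longrightarrow> \<exists>q\<in>dense_points. q \<in> X"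
proof -
  have "\<exists>Q::complex set. countable Q \<and> (\<forall>X. open X \<and> X \<noteq> {} \<longrightarrow> (\<exists>q\<in>Q. q \<in> X))"
    using countable_dense_exists by metis
  from someI_ex[OF this, folded dense_points_def]
  show "countable dense_points" "open X \<Longrightarrow> x \<in> X \<Longrightarrow> \<exists>q\<in>dense_points. q \<in> X"
    by blast+
qed

lemma parametrizes_simple_path:
  assumes "parametrizes f \<gamma>"
  shows "simple_path (f \<circ> circlepath 0 1)" 
    "pathfinish (f \<circ> circlepath 0 1) = pathstart (f \<circ> circlepath 0 1)"
    "path_image (f \<circ> circlepath 0 1) = \<gamma>"
proof -
  have "path_image (circlepath 0 1) = sphere (0::complex) 1" by simp
  moreover have "simple_path (circlepath 0 1)" by (simp add: simple_path_circlepath)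
  ultimately show "simple_path (f \<circ> circlepath 0 1)" 
    "pathfinish (f \<circ> circlepath 0 1) = pathstart (f \<circ> circlepath 0 1)"
    "path_image (f \<circ> circlepath 0 1) = \<gamma>"
    using assms by (auto simp: parametrizes_def path_image_compose pathfinish_compose pathstart_compose
        intro!: simple_path_continuous_image simp del: path_image_circlepath)
qed

lemma loop_is_simple_closed_path:
  assumes "\<gamma> \<in> self_avoiding_loops"
  obtains p where "simple_path p" "pathfinish p = pathstart p" "path_image p = \<gamma>"
  using assms parametrizes_simple_path that unfolding self_avoiding_loops_def by blast

lemma loop_topology:
  assumes "\<gamma> \<in> self_avoiding_loops"
  shows "compact \<gamma>" "connected \<gamma>" "open (inside \<gamma>)" "open (outside \<gamma>)" "inside \<gamma> \<noteq> {}"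
    "connected (inside \<gamma>)" "connected (outside \<gamma>)" "bounded (inside \<gamma>)" "\<gamma> \<noteq> {}"
    "frontier (inside \<gamma>) = \<gamma>" "frontier (outside \<gamma>) = \<gamma>" "\<not> bounded (outside \<gamma>)"
proof -
  obtain p where p: "simple_path p" "pathfinish p = pathstart p" "path_image p = \<gamma>"
    using loop_is_simple_closed_path[OF assms] .
  show "compact \<gamma>" "connected \<gamma>" "\<gamma> \<noteq> {}"
    using p compact_simple_path_image connected_simple_path_image path_image_nonempty by metis+
  show "open (inside \<gamma>)" "open (outside \<gamma>)" "inside \<gamma> \<noteq> {}"
    "connected (inside \<gamma>)" "connected (outside \<gamma>)" "bounded (inside \<gamma>)"
    "frontier (inside \<gamma>) = \<gamma>" "frontier (outside \<gamma>) = \<gamma>" "\<not> bounded (outside \<gamma>)"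
    using Jordan_inside_outside[OF p(1,2)] unfolding p(3) by blast+
qed

text \<open>Off the loop, the index of a Jordan curve is \<open>0\<close> outside and \<open>1\<close> or \<open>- 1\<close> inside. This turns
  the winding number in the generating events into a topological condition.\<close>

lemma nonzero_index_iff_inside:
  assumes "parametrizes f \<gamma>" "z \<notin> \<gamma>"
  shows "winding_number (f \<circ> circlepath 0 1) z \<noteq> 0 \<longleftrightarrow> z \<in> inside \<gamma>"
proof -
  note p = parametrizes_simple_path[OF assms(1)]
  show ?thesis
  proof (cases "z \<in> inside \<gamma>")
    case True
    then have "norm (winding_number (f \<circ> circlepath 0 1) z) = 1"
      using simple_closed_path_norm_winding_number_inside[OF p(1)] p(3) by simp
    with True show ?thesis by auto
  next
    case False
    then have "z \<in> outside \<gamma>" using assms(2) inside_Un_outside by blast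
    then show ?thesis
      using winding_number_zero_in_outside[of "f \<circ> circlepath 0 1" z] p False
      by (simp add: simple_path_imp_path)
  qed
qed

lemma inside_subset_simply_connected:
  assumes "simply_connected_domain D" "\<gamma> \<subseteq> D"
  shows "inside \<gamma> \<subseteq> D"
  using assms subset_simply_connected_imp_inside_subset unfolding simply_connected_domain_def by blast

text \<open>A ball that misses the loop is connected, so it lies on one side.\<close>

lemma ball_avoiding_loop:
  fixes \<gamma> :: "complex set"
  assumes "ball x e \<inter> \<gamma> = {}" "p \<in> ball x e" "q \<in> ball x e" "p \<in> inside \<gamma>"
  shows "q \<in> inside \<gamma>"
proof (rule ccontr)
  assume "q \<notin> inside \<gamma>"
  then have "q \<in> outside \<gamma>" using assms inside_Un_outside by blast
  then show False
    using inside_outside_intersect_connected[OF connected_ball, of \<gamma> x e] assms by blast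
qed

text \<open>Every point of a Jordan curve is a boundary point both of the inside and of the outside.\<close>

lemma dense_point_near_loop:
  assumes "\<gamma> \<in> self_avoiding_loops" "y \<in> \<gamma>" "open X" "y \<in> X"
  obtains p q where "p \<in> dense_points \<inter> X \<inter> inside \<gamma>" "q \<in> dense_points \<inter> X \<inter> outside \<gamma>"
proof -
  note t = loop_topology[OF assms(1)]
  have "y \<in> closure (inside \<gamma>)" "y \<in> closure (outside \<gamma>)"
    using assms(2) t(10,11) unfolding frontier_def by blast+
  then have "X \<inter> inside \<gamma> \<noteq> {}" "X \<inter> outside \<gamma> \<noteq> {}"
    using assms(3,4) by (meson disjoint_iff open_Int_closure_eq_empty)+
  then obtain x y where "x \<in> X \<inter> inside \<gamma>" "y \<in> X \<inter> outside \<gamma>" by blast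
  moreover have "open (X \<inter> inside \<gamma>)" "open (X \<inter> outside \<gamma>)" using t assms(3) by auto
  ultimately show ?thesis
    using dense_points(2) that by (meson IntD1 IntD2 IntI)
qed

text \<open>A neighbourhood free of outside points cannot meet the loop either, since outside points
  accumulate at every point of the loop. Therefore countably many conditions \<open>q \<notin> outside \<gamma>\<close> decide
  whether \<open>x\<close> is inside, although each of them allows \<open>q\<close> to lie on the loop.\<close>

lemma in_inside_iff_dense_points:
  assumes "\<gamma> \<in> self_avoiding_loops"
  shows "x \<in> inside \<gamma> \<longleftrightarrow> (\<exists>n. \<forall>q\<in>dense_points \<inter> ball x (1 / Suc n). q \<notin> outside \<gamma>)"
proof
  note t = loop_topology[OF assms(1)]
  assume "x \<in> inside \<gamma>"
  then obtain e where "e > 0" "ball x e \<subseteq> inside \<gamma>" using t(3) openE by blast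
  moreover then obtain n where "1 / real (Suc n) < e"
    using nat_approx_posE by blast
  ultimately have "ball x (1 / Suc n) \<subseteq> inside \<gamma>" by auto
  then show "\<exists>n. \<forall>q\<in>dense_points \<inter> ball x (1 / Suc n). q \<notin> outside \<gamma>"
    using inside_Int_outside by blast
next
  note t = loop_topology[OF assms(1)]
  assume "\<exists>n. \<forall>q\<in>dense_points \<inter> ball x (1 / Suc n). q \<notin> outside \<gamma>"
  then obtain n where n: "\<forall>q\<in>dense_points \<inter> ball x (1 / Suc n). q \<notin> outside \<gamma>" by blast
  have *: "ball x (1 / Suc n) \<inter> outside \<gamma> = {}"
    using n dense_points(2)[OF open_Int[OF open_ball t(4)]] by blast
  have x: "x \<in> ball x (1 / Suc n)" by simp
  have "x \<notin> \<gamma>"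
    using dense_point_near_loop[OF assms _ open_ball x] * by blast
  then show "x \<in> inside \<gamma>" using * x inside_Un_outside by blast
qed

text \<open>A compact subset of the open inside has a neighbourhood of uniform size inside; conversely dense
  points suffice by \<open>in_inside_iff_dense_points\<close>.\<close>

lemma compact_subset_inside_iff:
  assumes "\<gamma> \<in> self_avoiding_loops" "compact K"
  shows "K \<subseteq> inside \<gamma> \<longleftrightarrow> (\<exists>n. \<forall>q\<in>dense_points. (\<exists>x\<in>K. q \<in> ball x (1 / Suc n)) \<longrightarrow> q \<in> inside \<gamma>)"
    (is "_ \<longleftrightarrow> ?R")
proof
  note t = loop_topology[OF assms(1)]
  assume "K \<subseteq> inside \<gamma>"
  then obtain e where e: "e > 0" "(\<Union>x\<in>K. ball x e) \<subseteq> inside \<gamma>"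
    using compact_subset_open_imp_ball_epsilon_subset[OF assms(2) t(3)] by blast
  then obtain n where "1 / real (Suc n) < e"
    using nat_approx_posE by blast
  then have "(\<Union>x\<in>K. ball x (1 / Suc n)) \<subseteq> inside \<gamma>" using e(2) by fastforce
  then show ?R by blast
next
  assume ?R
  then obtain n where n: "\<forall>q\<in>dense_points. (\<exists>x\<in>K. q \<in> ball x (1 / Suc n)) \<longrightarrow> q \<in> inside \<gamma>" ..
  show "K \<subseteq> inside \<gamma>"
  proof
    fix x assume "x \<in> K"
    then have "\<forall>q\<in>dense_points \<inter> ball x (1 / Suc n). q \<notin> outside \<gamma>"
      using n inside_Int_outside[of \<gamma>] by blast
    then show "x \<in> inside \<gamma>" unfolding in_inside_iff_dense_points[OF assms(1)] ..
  qed
qed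

text \<open>A ball meets the loop exactly when it contains dense points of both sides. By compactness a loop
  that misses \<open>F\<close> misses all balls of some fixed radius centred in \<open>F\<close>.\<close>

lemma loop_avoids_closed_iff:
  assumes "\<gamma> \<in> self_avoiding_loops" "closed F"
  shows "\<gamma> \<inter> F = {} \<longleftrightarrow> (\<exists>n. \<forall>p\<in>dense_points. \<forall>q\<in>dense_points.
     (\<exists>x\<in>F. p \<in> ball x (1 / Suc n) \<and> q \<in> ball x (1 / Suc n)) \<longrightarrow> p \<in> inside \<gamma> \<longrightarrow> q \<in> inside \<gamma>)"
    (is "_ \<longleftrightarrow> ?R")
proof
  note t = loop_topology[OF assms(1)]
  assume "\<gamma> \<inter> F = {}"
  then obtain d where d: "d > 0" "\<forall>x\<in>\<gamma>. \<forall>y\<in>F. d \<le> dist x y"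
    using separate_compact_closed[OF t(1) assms(2)] by blast
  then obtain n where n: "1 / real (Suc n) < d"
    using nat_approx_posE by blast
  have "ball x (1 / Suc n) \<inter> \<gamma> = {}" if "x \<in> F" for x
    using d(2) that n by (force simp: dist_commute)
  then show ?R using ball_avoiding_loop by blast
next
  assume R: ?R
  then obtain n where n: "\<forall>p\<in>dense_points. \<forall>q\<in>dense_points.
     (\<exists>x\<in>F. p \<in> ball x (1 / Suc n) \<and> q \<in> ball x (1 / Suc n)) \<longrightarrow> p \<in> inside \<gamma> \<longrightarrow> q \<in> inside \<gamma>"
    by blast
  show "\<gamma> \<inter> F = {}"
  proof (rule ccontr)
    assume "\<gamma> \<inter> F \<noteq> {}"
    then obtain y where y: "y \<in> \<gamma>" "y \<in> F" by blast
    have "y \<in> ball y (1 / Suc n)" by simp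
    from dense_point_near_loop[OF assms(1) y(1) open_ball this]
    obtain p q where "p \<in> dense_points \<inter> ball y (1 / Suc n) \<inter> inside \<gamma>"
      "q \<in> dense_points \<inter> ball y (1 / Suc n) \<inter> outside \<gamma>" .
    with n y(2) inside_Int_outside show False by blast
  qed
qed

section \<open>The hole of an annular region\<close>

text \<open>An annulus has only two ends, and the complement of its image cannot have more pieces than ends.
  Choose disjoint open neighbourhoods of the three pieces. What they leave uncovered is a compact
  subset of \<open>A\<close>, so the images of thin annuli near the two boundary circles are covered; being
  connected, each lies in one neighbourhood. The third neighbourhood meets \<open>A\<close> only in the image of a
  compact annulus, so its piece is open as well as closed, which is impossible.\<close>

lemma homeomorphic_annulus_complement_pieces:
  fixes f :: "complex \<Rightarrow> complex"
  assumes f: "homeomorphism {z. 1 < norm z \<and> norm z < R} A f g"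
    and A: "open A" "bounded A"
    and Q: "closed Q1" "closed Q2" "closed Q3" "Q1 \<union> Q2 \<union> Q3 = - A"
      "Q1 \<inter> Q2 = {}" "Q1 \<inter> Q3 = {}" "Q2 \<inter> Q3 = {}"
  shows "Q1 = {} \<or> Q2 = {} \<or> Q3 = {}"
proof (rule ccontr)
  assume "\<not> ?thesis"
  then have ne: "Q1 \<noteq> {}" "Q2 \<noteq> {}" "Q3 \<noteq> {}" by auto
  have comp: "x \<in> Q1 \<or> x \<in> Q2 \<or> x \<in> Q3" if "x \<notin> A" for x using Q(4) that by blast
  obtain W V where WV: "open W" "open V" "Q1 \<subseteq> W" "Q2 \<union> Q3 \<subseteq> V" "W \<inter> V = {}"
    using separation_normal[of Q1 "Q2 \<union> Q3"] Q by (metis Int_Un_distrib closed_Un sup_bot.right_neutral)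
  obtain W' V' where WV': "open W'" "open V'" "Q2 \<subseteq> W'" "Q3 \<subseteq> V'" "W' \<inter> V' = {}"
    using separation_normal[of Q2 "Q3"] Q by auto
  define W1 W2 W3 where "W1 = W" and "W2 = V \<inter> W'" and "W3 = V \<inter> V'"
  note W_defs = W1_def W2_def W3_def
  have W: "open W1" "open W2" "open W3" "W1 \<inter> W2 = {}" "W1 \<inter> W3 = {}" "W2 \<inter> W3 = {}"
    "Q1 \<subseteq> W1" "Q2 \<subseteq> W2" "Q3 \<subseteq> W3"
    using WV WV' unfolding W_defs by auto
  let ?Ann = "{z::complex. 1 < norm z \<and> norm z < R}"
  define C where "C = - (W1 \<union> W2 \<union> W3)"
  have CA: "C \<subseteq> A" using W Q(4) unfolding C_def by blast
  have "closed C" using W(1-3) unfolding C_def by (intro closed_Compl open_Un)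
  with CA A(2) have "compact C" using bounded_subset compact_eq_bounded_closed by blast
  then have "compact (g ` C)"
    using f CA unfolding homeomorphism_def by (meson compact_continuous_image continuous_on_subset)
  then have cn: "compact (insert ((1 + R) / 2) (norm ` g ` C))"
    by (intro compact_insert compact_continuous_image[of "g ` C" norm] continuous_intros)
  have "A \<noteq> {}"
  proof
    assume "A = {}"
    then have "UNIV = Q1 \<union> (Q2 \<union> Q3)" using Q(4) by auto
    then show False
      using connected_closedD[OF connected_UNIV, of Q1 "Q2 \<union> Q3"] Q ne by auto
  qed
  then have "?Ann \<noteq> {}" using f by (auto simp: homeomorphism_def)
  then have R: "1 < R" by auto
  have in_Ann: "g x \<in> ?Ann" if "x \<in> A" for x using f that by (auto simp: homeomorphism_def)
  obtain r s where rs: "1 < r" "s < R" "r < R" "1 < s"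
    "\<And>x. x \<in> C \<Longrightarrow> r \<le> norm (g x) \<and> norm (g x) \<le> s"
  proof -
    let ?N = "insert ((1 + R) / 2) (norm ` g ` C)"
    obtain r where r: "r \<in> ?N" "\<forall>t\<in>?N. r \<le> t" using compact_attains_inf[OF cn] by blast
    obtain s where s: "s \<in> ?N" "\<forall>t\<in>?N. t \<le> s" using compact_attains_sup[OF cn] by blast
    have N: "1 < t \<and> t < R" if "t \<in> ?N" for t
      using that in_Ann CA R by auto
    show ?thesis using that[of r s] r s N by blast
  qed
  define L G M where "L = f ` {z. 1 < norm z \<and> norm z < r}"
    and "G = f ` {z. s < norm z \<and> norm z < R}" and "M = f ` {z. r \<le> norm z \<and> norm z \<le> s}"
  have contf: "continuous_on ?Ann f" using f by (simp add: homeomorphism_def)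
  have "connected {z::complex. 1 < norm z \<and> norm z < r}" "connected {z::complex. s < norm z \<and> norm z < R}"
    using connected_annulus(1)[where a = "0::complex"] by auto
  then have conn: "connected L" "connected G"
    using rs unfolding L_def G_def
    by (auto intro!: connected_continuous_image continuous_on_subset[OF contf])
  have "compact {z::complex. r \<le> norm z \<and> norm z \<le> s}"
  proof -
    have "{z::complex. r \<le> norm z \<and> norm z \<le> s} = cball 0 s - ball 0 r" by auto
    then show ?thesis by (metis compact_cball compact_diff open_ball)
  qed
  then have "compact M" using rs unfolding M_def
    by (auto intro!: compact_continuous_image continuous_on_subset[OF contf])
  then have M: "closed M" by (rule compact_imp_closed)
  have fA: "f z \<in> A" "g (f z) = z" if "z \<in> ?Ann" for z using f that by (auto simp: homeomorphism_def)
  have MA: "M \<subseteq> A" using fA rs unfolding M_def by auto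
  have A_parts: "A \<subseteq> L \<union> M \<union> G"
  proof
    fix x assume x: "x \<in> A"
    have fg: "f (g x) = x" using f x by (auto simp: homeomorphism_def)
    have "g x \<in> {z. 1 < norm z \<and> norm z < r} \<union> {z. r \<le> norm z \<and> norm z \<le> s}
        \<union> {z. s < norm z \<and> norm z < R}"
      using in_Ann[OF x] by auto
    from imageI[OF this, of f] show "x \<in> L \<union> M \<union> G"
      unfolding fg L_def M_def G_def image_Un .
  qed
  have "norm z < r \<Longrightarrow> f z \<notin> C" "s < norm z \<Longrightarrow> f z \<notin> C" if "z \<in> ?Ann" for z
    using rs(5)[of "f z"] fA[OF that] by auto
  then have "C \<inter> L = {}" "C \<inter> G = {}" using rs(1-4) unfolding L_def G_def by auto
  then have LG: "L \<subseteq> W1 \<union> W2 \<union> W3" "G \<subseteq> W1 \<union> W2 \<union> W3" unfolding C_def by auto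
  have one: "(E \<inter> W1 = {} \<and> E \<inter> W2 = {}) \<or> (E \<inter> W1 = {} \<and> E \<inter> W3 = {}) \<or> (E \<inter> W2 = {} \<and> E \<inter> W3 = {})"
    if "connected E" "E \<subseteq> W1 \<union> W2 \<union> W3" for E
  proof -
    have "W1 \<inter> E = {} \<or> (W2 \<union> W3) \<inter> E = {}"
      using that(2) W by (intro connectedD[OF that(1), of W1 "W2 \<union> W3"]) auto
    moreover have "W2 \<inter> E = {} \<or> (W1 \<union> W3) \<inter> E = {}"
      using that(2) W by (intro connectedD[OF that(1), of W2 "W1 \<union> W3"]) auto
    ultimately show ?thesis by blast
  qed
  have no_clopen: False if "closed S" "S \<noteq> {}" "open W" "S \<subseteq> W" "S \<inter> A = {}" "W \<subseteq> S \<union> A" "L \<inter> W = {}" "G \<inter> W = {}" 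
    for S W
  proof -
    have "W \<inter> A \<subseteq> M" using A_parts that(7,8) by blast
    then have "S = W - M" using that(4-6) MA by blast
    then have "open S" using M that by (simp add: open_Diff)
    then have "S = UNIV" using that(1,2) clopen[of S] by blast
    with that(5) \<open>A \<noteq> {}\<close> show False by blast
  qed
  have "Q1 \<inter> A = {}" "Q2 \<inter> A = {}" "Q3 \<inter> A = {}" "W1 \<subseteq> Q1 \<union> A" "W2 \<subseteq> Q2 \<union> A" "W3 \<subseteq> Q3 \<union> A"
    using W(4-9) Q(4) comp by blast+
  then have "L \<inter> W1 \<noteq> {} \<or> G \<inter> W1 \<noteq> {}" "L \<inter> W2 \<noteq> {} \<or> G \<inter> W2 \<noteq> {}" "L \<inter> W3 \<noteq> {} \<or> G \<inter> W3 \<noteq> {}"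
    using no_clopen[OF Q(1) ne(1) W(1) W(7)] no_clopen[OF Q(2) ne(2) W(2) W(8)]
      no_clopen[OF Q(3) ne(3) W(3) W(9)] by blast+
  with one[OF conn(1) LG(1)] one[OF conn(2) LG(2)] show False by blast
qed

lemma annular_region_homeomorphism:
  assumes "annular_region A"
  obtains R f g where "1 < R" "homeomorphism {z::complex. 1 < norm z \<and> norm z < R} A f g"
proof -
  obtain R f where R: "1 < R" and f: "conformal_map f {z. 1 < norm z \<and> norm z < R} A"
    using assms unfolding annular_region_def by blast
  let ?Ann = "{z::complex. 1 < norm z \<and> norm z < R}"
  have op: "open ?Ann" 
    by (intro open_Collect_conj open_Collect_less continuous_intros)
  have f': "f holomorphic_on ?Ann" "inj_on f ?Ann" "f ` ?Ann = A"
    using f unfolding conformal_map_def bij_betw_def by auto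
  obtain g where g: "g holomorphic_on (f ` ?Ann)" "\<And>z. z \<in> ?Ann \<Longrightarrow> g (f z) = z"
    using holomorphic_has_inverse[OF f'(1) op f'(2)] by metis
  have "homeomorphism ?Ann A f g"
    unfolding homeomorphism_def
  proof (intro conjI)
    show "continuous_on ?Ann f" "continuous_on A g"
      using f' g holomorphic_on_imp_continuous_on by auto
    show "\<forall>x\<in>?Ann. g (f x) = x" using g by auto
    show "f ` ?Ann = A" by fact
    show "g ` A = ?Ann" using g(2) f'(3) by (force simp: image_iff)
    show "\<forall>y\<in>A. f (g y) = y" using g(2) f'(3) by force
  qed
  with R show ?thesis by (rule that)
qed

text \<open>If there were no bounded component, \<open>A\<close> would be simply connected, unlike the annulus. Two
  bounded components could be separated by compact relatively open subsets of the complement (Sura-Bura),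
  and together with the remaining unbounded part of the complement these would be three nonempty pieces.\<close>

lemma annular_region_hole_unique:
  assumes A: "annular_region A"
  shows "\<exists>!K. K \<in> components (- A) \<and> bounded K"
proof -
  obtain R f g where R: "1 < R" and f: "homeomorphism {z::complex. 1 < norm z \<and> norm z < R} A f g"
    using annular_region_homeomorphism[OF A] .
  have opA: "open A" and bA: "bounded A" using A unfolding annular_region_def by auto
  let ?Ann = "{z::complex. 1 < norm z \<and> norm z < R}"
  have cA: "closed (- A)" using opA by blast
  have conA: "connected ?Ann" using connected_annulus(1)[where a = "0::complex" and ?r1.0 = 1 and ?r2.0 = R] by simp
  have "\<exists>K. K \<in> components (- A) \<and> bounded K"
  proof (rule ccontr)
    assume "\<not> ?thesis"
    moreover have "connected A"
      using f conA unfolding homeomorphism_def by (metis connected_continuous_image)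
    ultimately have "simply_connected A"
      using simply_connected_eq_unbounded_complement_components[OF opA] by blast
    then have "simply_connected ?Ann"
      using homeomorphic_simply_connected_eq f homeomorphic_def by blast
    then have "winding_number (circlepath 0 ((1 + R) / 2)) 0 = 0"
      using R by (intro simply_connected_imp_winding_number_zero) auto
    then show False using R winding_number_circlepath_centre[of "(1 + R) / 2" 0] by simp
  qed
  moreover have "K1 = K2" if K: "K1 \<in> components (- A)" "bounded K1" "K2 \<in> components (- A)" "bounded K2" for K1 K2
  proof (rule ccontr)
    assume "K1 \<noteq> K2"
    then have disj: "K1 \<inter> K2 = {}" using K components_nonoverlap by blast
    have comp: "compact K1" "compact K2"
      using K cA closed_components compact_eq_bounded_closed by blast+
    have lc: "locally compact (- A)" using cA closed_imp_locally_compact by blast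
    obtain Q1 where Q1: "openin (top_of_set (- A)) Q1" "compact Q1" "K1 \<subseteq> Q1" "Q1 \<subseteq> - K2"
      using Sura_Bura_clopen_subset[OF lc K(1) comp(1), of "- K2"] comp(2) disj
      by (metis compact_imp_closed disjoint_eq_subset_Compl open_Compl)
    obtain Q2 where Q2: "openin (top_of_set (- A)) Q2" "compact Q2" "K2 \<subseteq> Q2" "Q2 \<subseteq> - Q1"
      using Sura_Bura_clopen_subset[OF lc K(3) comp(2), of "- Q1"] Q1
      by (metis compact_imp_closed compl_le_swap1 open_Compl)
    obtain U1 U2 where U: "open U1" "Q1 = - A \<inter> U1" "open U2" "Q2 = - A \<inter> U2"
      using Q1(1) Q2(1) openin_open by metis
    define Q3 where "Q3 = - (A \<union> U1 \<union> U2)"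
    have "closed Q3" unfolding Q3_def using U opA by blast
    moreover have "Q1 \<union> Q2 \<union> Q3 = - A" "Q1 \<inter> Q2 = {}" "Q1 \<inter> Q3 = {}" "Q2 \<inter> Q3 = {}"
      using U Q2(4) unfolding Q3_def by blast+
    ultimately have "Q1 = {} \<or> Q2 = {} \<or> Q3 = {}"
      using homeomorphic_annulus_complement_pieces[OF f opA bA] Q1(2) Q2(2) compact_imp_closed by metis
    moreover have "Q1 \<noteq> {}" "Q2 \<noteq> {}" using Q1 Q2 K in_components_nonempty by blast+
    moreover have "Q3 \<noteq> {}"
    proof
      assume "Q3 = {}"
      with \<open>Q1 \<union> Q2 \<union> Q3 = - A\<close> have "bounded (- A)"
        using Q1(2) Q2(2) compact_imp_bounded by (metis bounded_Un sup_bot.right_neutral)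
      with bA have "bounded (UNIV::complex set)" by (metis bounded_Un Compl_partition)
      then show False by simp
    qed
    ultimately show False by blast
  qed
  ultimately show ?thesis by blast
qed

lemma hole_annular_region:
  assumes "annular_region A"
  shows "compact (hole A)" "hole A \<inter> A = {}" "hole A \<in> components (- A)"
proof -
  have *: "hole A \<in> components (- A) \<and> bounded (hole A)"
    using theI'[OF annular_region_hole_unique[OF assms]] unfolding hole_def .
  then show "hole A \<inter> A = {}" "hole A \<in> components (- A)"
    using in_components_subset by blast+
  have "closed (- A)" using assms unfolding annular_region_def by blast
  then show "compact (hole A)" using * closed_components compact_eq_bounded_closed by blast
qed

lemma hole_eqI:
  assumes "annular_region A" "K \<in> components (- A)" "bounded K"
  shows "hole A = K"
  unfolding hole_def by (rule the1_equality[OF annular_region_hole_unique[OF assms(1)]]) (simp add: assms)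

text \<open>Round annuli are the only annular regions that have to be exhibited: they already generate the
  events that a point is enclosed.\<close>

lemma round_annulus:
  assumes "0 < a" "a < b"
  shows "annular_region {z. a < norm (z - q) \<and> norm (z - q) < b}"
    "hole {z. a < norm (z - q) \<and> norm (z - q) < b} = cball q a"
proof -
  let ?A = "{z::complex. a < norm (z - q) \<and> norm (z - q) < b}"
  have op: "open ?A" 
    by (intro open_Collect_conj open_Collect_less continuous_intros)
  have "?A \<subseteq> ball q b" by (auto simp: dist_norm norm_minus_commute)
  then have bd: "bounded ?A" using bounded_ball bounded_subset by blast
  have "conformal_map (\<lambda>z. q + of_real a * z) {z. 1 < norm z \<and> norm z < b / a} ?A"
    unfolding conformal_map_def
  proof
    show "(\<lambda>z. q + of_real a * z) holomorphic_on {z. 1 < norm z \<and> norm z < b / a}"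
      by (intro holomorphic_intros)
    show "bij_betw (\<lambda>z. q + of_real a * z) {z. 1 < norm z \<and> norm z < b / a} ?A"
      using assms
      by (intro bij_betw_byWitness[where f' = "\<lambda>w. (w - q) / of_real a"])
        (auto simp: norm_mult norm_divide field_simps)
  qed
  moreover have "b / a > 1" using assms by simp
  ultimately show ann: "annular_region ?A"
    using op bd unfolding annular_region_def by blast
  have "cball q a \<in> components (- ?A)"
    unfolding in_components_maximal
  proof (intro conjI allI impI)
    show "cball q a \<noteq> {}" "cball q a \<subseteq> - ?A" "connected (cball q a)"
      using assms by (auto simp: dist_norm norm_minus_commute)
    fix d assume d: "d \<noteq> {} \<and> cball q a \<subseteq> d \<and> d \<subseteq> - ?A \<and> connected d"
    have "d \<subseteq> ball q b \<union> - cball q a" using assms by (auto simp: dist_norm)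
    moreover have "q \<in> cball q a" using assms by simp
    moreover have "q \<in> ball q b" using assms by simp
    ultimately have "ball q b \<inter> d \<noteq> {}" using d by blast
    moreover have "ball q b \<inter> - cball q a \<inter> d = {}"
      using d by (auto simp: dist_norm norm_minus_commute)
    ultimately have "- cball q a \<inter> d = {}"
      using connectedD[of d "ball q b" "- cball q a"] d \<open>d \<subseteq> ball q b \<union> - cball q a\<close>
      by (metis open_ball open_Compl closed_cball)
    then show "d = cball q a" using d by blast
  qed
  then show "hole ?A = cball q a" using hole_eqI[OF ann] by simp
qed

section \<open>The sigma-field generated by enclosed points\<close>

lemma loops_around_hole_eq:
  assumes "annular_region A"
  shows "loops_around_hole A = {\<gamma> \<in> self_avoiding_loops. \<gamma> \<subseteq> A \<and> hole A \<subseteq> inside \<gamma>}"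
proof -
  have "(\<exists>f. parametrizes f \<gamma> \<and> (\<forall>z\<in>hole A. winding_number (f \<circ> circlepath 0 1) z \<noteq> 0))
      \<longleftrightarrow> hole A \<subseteq> inside \<gamma>" if \<gamma>: "\<gamma> \<in> self_avoiding_loops" "\<gamma> \<subseteq> A" for \<gamma>
  proof -
    have "z \<notin> \<gamma>" if "z \<in> hole A" for z
      using hole_annular_region(2)[OF assms] \<gamma>(2) that by blast
    then have "(\<forall>z\<in>hole A. winding_number (f \<circ> circlepath 0 1) z \<noteq> 0) \<longleftrightarrow> hole A \<subseteq> inside \<gamma>"
      if "parametrizes f \<gamma>" for f
      using nonzero_index_iff_inside[OF that] by blast
    moreover obtain f where "parametrizes f \<gamma>" using \<gamma>(1) unfolding self_avoiding_loops_def by blast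
    ultimately show ?thesis by blast
  qed
  then show ?thesis unfolding loops_around_hole_def by blast
qed

text \<open>A second description of the loop space; it is shown below to have the same measurable sets as
  \<open>loop_space\<close>.\<close>

definition enclosure_space :: "complex set measure" where
  "enclosure_space = sigma self_avoiding_loops (range (surrounding_loops UNIV))"

lemma surrounding_loops_subset: "surrounding_loops D z \<subseteq> self_avoiding_loops"
  unfolding surrounding_loops_def by blast

lemma space_enclosure_space [simp]: "space enclosure_space = self_avoiding_loops"
  unfolding enclosure_space_def by (rule space_measure_of) (use surrounding_loops_subset in blast)

lemma sets_enclosure_space:
  "sets enclosure_space = sigma_sets self_avoiding_loops (range (surrounding_loops UNIV))"
  unfolding enclosure_space_def by (rule sets_measure_of) (use surrounding_loops_subset in blast)

lemma enclosing_measurable: "{\<gamma> \<in> space enclosure_space. q \<in> inside \<gamma>} \<in> sets enclosure_space"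
proof -
  have "{\<gamma> \<in> space enclosure_space. q \<in> inside \<gamma>} = surrounding_loops UNIV q"
    by (auto simp: surrounding_loops_def)
  then show ?thesis unfolding sets_enclosure_space by auto
qed

lemma loops_in_open_measurable:
  assumes "open V"
  shows "{\<gamma> \<in> self_avoiding_loops. \<gamma> \<subseteq> V} \<in> sets enclosure_space"
proof -
  have "closed (- V)" using assms by blast
  then have "{\<gamma> \<in> self_avoiding_loops. \<gamma> \<subseteq> V} = {\<gamma> \<in> space enclosure_space. (\<exists>n. \<forall>p\<in>dense_points. \<forall>q\<in>dense_points.
     (\<exists>x\<in>- V. p \<in> ball x (1 / Suc n) \<and> q \<in> ball x (1 / Suc n)) \<longrightarrow> p \<in> inside \<gamma> \<longrightarrow> q \<in> inside \<gamma>)}"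
    using loop_avoids_closed_iff unfolding space_enclosure_space disjoint_eq_subset_Compl double_complement
    by blast
  also have "\<dots> \<in> sets enclosure_space"
    by (intro sets.sets_Collect_countable_Ex sets.sets_Collect_countable_All' dense_points(1)
        sets.sets_Collect_imp sets.sets_Collect_const enclosing_measurable)
  finally show ?thesis .
qed

lemma loops_around_compact_measurable:
  assumes "compact K"
  shows "{\<gamma> \<in> self_avoiding_loops. K \<subseteq> inside \<gamma>} \<in> sets enclosure_space"
proof -
  have "{\<gamma> \<in> self_avoiding_loops. K \<subseteq> inside \<gamma>} = {\<gamma> \<in> space enclosure_space.
      \<exists>n. \<forall>q\<in>dense_points. (\<exists>x\<in>K. q \<in> ball x (1 / Suc n)) \<longrightarrow> q \<in> inside \<gamma>}"
    using compact_subset_inside_iff[OF _ assms] by auto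
  also have "\<dots> \<in> sets enclosure_space"
    by (intro sets.sets_Collect_countable_Ex sets.sets_Collect_countable_All' dense_points(1)
        sets.sets_Collect_imp sets.sets_Collect_const enclosing_measurable)
  finally show ?thesis .
qed

lemma loops_around_hole_subset: "loops_around_hole A \<subseteq> self_avoiding_loops"
  unfolding loops_around_hole_def by blast

text \<open>A loop around \<open>q\<close> also surrounds a small disc around \<open>q\<close> and stays in a large one. The shift by
  \<open>2\<close> makes the outer radius exceed the inner one for every \<open>n\<close>.\<close>

lemma surrounding_loops_UNIV_eq_Union:
  "surrounding_loops UNIV q
     = (\<Union>n. loops_around_hole {z. 1 / (n + 2) < norm (z - q) \<and> norm (z - q) < real n + 2})"
  (is "_ = (\<Union>n. loops_around_hole (?A n))")
proof -
  have *: "1 / (real n + 2) < real n + 2" for n :: nat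
    by (rule less_le_trans[of _ 1]) (auto simp: field_simps)
  have U: "loops_around_hole (?A n) =
      {\<gamma> \<in> self_avoiding_loops. \<gamma> \<subseteq> ?A n \<and> cball q (1 / (real n + 2)) \<subseteq> inside \<gamma>}" for n
    using loops_around_hole_eq[OF round_annulus(1)] round_annulus(2) * by auto
  have "\<exists>n. \<gamma> \<subseteq> ?A n \<and> cball q (1 / (real n + 2)) \<subseteq> inside \<gamma>"
    if \<gamma>: "\<gamma> \<in> self_avoiding_loops" "q \<in> inside \<gamma>" for \<gamma>
  proof -
    note t = loop_topology[OF \<gamma>(1)]
    obtain e where e: "e > 0" "cball q e \<subseteq> inside \<gamma>"
      using t(3) \<gamma>(2) open_contains_cball by blast
    obtain b where b: "\<gamma> \<subseteq> ball q b"
      using compact_imp_bounded[OF t(1)] bounded_subset_ballD by blast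
    obtain n :: nat where n: "max (1 / e) b < n" using reals_Archimedean2 by blast
    have "1 / (real n + 2) \<le> e"
    proof -
      have "1 / e < real n + 2" using n by simp
      then show ?thesis using e(1) by (simp add: field_simps)
    qed
    then have "cball q (1 / (real n + 2)) \<subseteq> inside \<gamma>" using e(2) by auto
    moreover have "\<gamma> \<inter> inside \<gamma> = {}" using inside_no_overlap by blast
    ultimately have out: "\<gamma> \<inter> cball q (1 / (real n + 2)) = {}" by blast
    have "\<gamma> \<subseteq> ?A n"
    proof
      fix x assume x: "x \<in> \<gamma>"
      have "norm (x - q) < b" using b x by (auto simp: dist_norm norm_minus_commute)
      moreover have "\<not> norm (x - q) \<le> 1 / (real n + 2)"
        using out x by (auto simp: dist_norm norm_minus_commute)
      ultimately show "x \<in> ?A n" using n by simp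
    qed
    with \<open>cball q (1 / (real n + 2)) \<subseteq> inside \<gamma>\<close> show ?thesis by blast
  qed
  moreover have "q \<in> cball q (1 / (real n + 2))" for n by simp
  ultimately have "q \<in> inside \<gamma> \<longleftrightarrow> (\<exists>n. \<gamma> \<subseteq> ?A n \<and> cball q (1 / (real n + 2)) \<subseteq> inside \<gamma>)"
    if "\<gamma> \<in> self_avoiding_loops" for \<gamma>
    using that by (meson subsetD)
  then have "surrounding_loops UNIV q = {\<gamma> \<in> self_avoiding_loops.
      \<exists>n. \<gamma> \<subseteq> ?A n \<and> cball q (1 / (real n + 2)) \<subseteq> inside \<gamma>}"
    unfolding surrounding_loops_def by (intro Collect_cong) auto
  moreover have "{\<gamma> \<in> self_avoiding_loops. \<exists>n. P n \<gamma>} = (\<Union>n. {\<gamma> \<in> self_avoiding_loops. P n \<gamma>})"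
    for P :: "nat \<Rightarrow> complex set \<Rightarrow> bool" by auto
  ultimately show ?thesis unfolding U by (simp only:)
qed

lemma space_loop_space: "space loop_space = self_avoiding_loops"
  unfolding loop_space_def by (rule space_measure_of) (use loops_around_hole_subset in blast)

proposition sets_loop_space: "sets loop_space = sets enclosure_space"
proof
  have gen: "sets loop_space = sigma_sets self_avoiding_loops {loops_around_hole A | A. annular_region A}"
    unfolding loop_space_def by (rule sets_measure_of) (use loops_around_hole_subset in blast)
  have "loops_around_hole A \<in> sets enclosure_space" if A: "annular_region A" for A
  proof -
    have "loops_around_hole A = {\<gamma> \<in> self_avoiding_loops. \<gamma> \<subseteq> A} \<inter> {\<gamma> \<in> self_avoiding_loops. hole A \<subseteq> inside \<gamma>}"
      unfolding loops_around_hole_eq[OF A] by blast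
    moreover have "open A" using A unfolding annular_region_def by blast
    note sets.Int[OF loops_in_open_measurable[OF this]
      loops_around_compact_measurable[OF hole_annular_region(1)[OF A]]]
    ultimately show ?thesis by (simp only:)
  qed
  then show "sets loop_space \<subseteq> sets enclosure_space"
    unfolding gen
    by (intro sets.sigma_sets_subset[where M = enclosure_space, unfolded space_enclosure_space] subsetI)
      (elim CollectE exE conjE, simp)
  have "surrounding_loops UNIV q \<in> sets loop_space" for q
    unfolding surrounding_loops_UNIV_eq_Union
  proof (intro sets.countable_UN, clarify)
    fix n :: nat
    have "1 / (real n + 2) < real n + 2"
      by (rule less_le_trans[of _ 1]) (auto simp: field_simps)
    then have "annular_region {z. 1 / (real n + 2) < norm (z - q) \<and> norm (z - q) < real n + 2}"
      by (intro round_annulus) auto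
    then show "loops_around_hole {z. 1 / (real n + 2) < norm (z - q) \<and> norm (z - q) < real n + 2} \<in> sets loop_space"
      unfolding gen by blast
  qed
  then show "sets enclosure_space \<subseteq> sets loop_space"
    unfolding sets_enclosure_space
    by (intro sets.sigma_sets_subset[where M = loop_space, unfolded space_loop_space]) (rule image_subsetI)
qed

lemma loop_measure_facts:
  assumes "loop_measure \<mu>"
  shows "sets \<mu> = sets enclosure_space" "space \<mu> = self_avoiding_loops"
    "sets \<mu> = sigma_sets self_avoiding_loops (range (surrounding_loops UNIV))"
proof -
  show "sets \<mu> = sets enclosure_space" using assms sets_loop_space unfolding loop_measure_def by simp
  then show "space \<mu> = self_avoiding_loops"
    "sets \<mu> = sigma_sets self_avoiding_loops (range (surrounding_loops UNIV))"
    using sets_eq_imp_space_eq[of \<mu> enclosure_space] sets_enclosure_space space_enclosure_space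
    by (simp_all only:)
qed

lemma surrounding_loops_measurable:
  assumes "loop_measure \<mu>" "open D"
  shows "surrounding_loops D z \<in> sets \<mu>"
proof -
  have "surrounding_loops D z = {\<gamma> \<in> self_avoiding_loops. \<gamma> \<subseteq> D} \<inter> {\<gamma> \<in> space enclosure_space. z \<in> inside \<gamma>}"
    unfolding surrounding_loops_def space_enclosure_space by blast
  then show ?thesis
    using sets.Int[OF loops_in_open_measurable[OF assms(2)] enclosing_measurable]
      loop_measure_facts(1)[OF assms(1)] by (simp only:)
qed

section \<open>Conformal images of loops\<close>

lemma conformal_map_inverse:
  assumes "open D" "conformal_map \<Phi> D D'"
  obtains \<Psi> where "conformal_map \<Psi> D' D" "\<And>z. z \<in> D \<Longrightarrow> \<Psi> (\<Phi> z) = z" "\<And>w. w \<in> D' \<Longrightarrow> \<Phi> (\<Psi> w) = w"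
    "\<And>z. z \<in> D \<Longrightarrow> deriv \<Phi> z * deriv \<Psi> (\<Phi> z) = 1"
proof -
  have \<Phi>: "\<Phi> holomorphic_on D" "inj_on \<Phi> D" "\<Phi> ` D = D'"
    using assms(2) unfolding conformal_map_def bij_betw_def by auto
  obtain \<Psi> where \<Psi>: "\<Psi> holomorphic_on \<Phi> ` D" "\<And>z. z \<in> D \<Longrightarrow> deriv \<Phi> z * deriv \<Psi> (\<Phi> z) = 1"
    "\<And>z. z \<in> D \<Longrightarrow> \<Psi> (\<Phi> z) = z"
    using holomorphic_has_inverse[OF \<Phi>(1) assms(1) \<Phi>(2)] by metis
  have inv: "\<Phi> (\<Psi> w) = w \<and> \<Psi> w \<in> D" if "w \<in> D'" for w
    using \<Psi>(3) \<Phi>(3) that by auto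
  have "bij_betw \<Psi> D' D"
    by (rule bij_betw_byWitness[where f' = \<Phi>]) (use inv \<Psi>(3) \<Phi>(3) in auto)
  then have "conformal_map \<Psi> D' D" using \<Psi>(1) \<Phi>(3) unfolding conformal_map_def by simp
  then show ?thesis using that \<Psi> inv by blast
qed

text \<open>The image of the inside is bounded and open with its boundary on the image loop, so a component of
  the complement of the image loop that meets it cannot leave it. Simple connectedness of \<open>D\<close> is what places the inside in the domain of
  \<open>\<Phi>\<close>.\<close>

lemma conformal_image_inside:
  assumes D: "simply_connected_domain D" and \<Phi>: "\<Phi> holomorphic_on D" "inj_on \<Phi> D"
    and \<gamma>: "\<gamma> \<in> self_avoiding_loops" "\<gamma> \<subseteq> D" and z: "z \<in> inside \<gamma>"
  shows "\<Phi> z \<in> inside (\<Phi> ` \<gamma>)"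
proof -
  note t = loop_topology[OF \<gamma>(1)]
  have I: "inside \<gamma> \<subseteq> D" using inside_subset_simply_connected[OF D \<gamma>(2)] .
  have cont: "continuous_on D \<Phi>" using \<Phi>(1) by (rule holomorphic_on_imp_continuous_on)
  have cl: "closure (inside \<gamma>) = inside \<gamma> \<union> \<gamma>"
    using closure_Un_frontier[of "inside \<gamma>"] t(10) by simp
  have "compact (closure (inside \<gamma>))" using t(8) by simp
  then have comp: "compact (\<Phi> ` closure (inside \<gamma>))"
    using cl I \<gamma>(2) by (intro compact_continuous_image continuous_on_subset[OF cont]) auto
  have "open (\<Phi> ` inside \<gamma>)"
    by (rule open_mapping_thm3) (use t(3) I \<Phi> in \<open>auto intro: holomorphic_on_subset inj_on_subset\<close>)
  moreover have "closure (\<Phi> ` inside \<gamma>) \<subseteq> \<Phi> ` closure (inside \<gamma>)"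
    using comp by (intro closure_minimal image_mono closure_subset compact_imp_closed)
  ultimately have fr: "frontier (\<Phi> ` inside \<gamma>) \<subseteq> \<Phi> ` \<gamma>"
    unfolding frontier_def cl by (auto simp: interior_open)
  have "\<Phi> z \<notin> \<Phi> ` \<gamma>"
    using z I \<gamma>(2) inside_no_overlap[of \<gamma>] inj_onD[OF \<Phi>(2)] by (metis disjoint_iff image_iff subsetD)
  let ?C = "connected_component_set (- \<Phi> ` \<gamma>) (\<Phi> z)"
  have "?C \<subseteq> \<Phi> ` inside \<gamma>"
  proof (rule ccontr)
    assume "\<not> ?thesis"
    then have "?C - \<Phi> ` inside \<gamma> \<noteq> {}" by blast
    moreover have "\<Phi> z \<in> ?C \<inter> \<Phi> ` inside \<gamma>" using \<open>\<Phi> z \<notin> \<Phi> ` \<gamma>\<close> z by simp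
    ultimately have "?C \<inter> frontier (\<Phi> ` inside \<gamma>) \<noteq> {}"
      using connected_Int_frontier[OF connected_connected_component] by blast
    moreover have "?C \<subseteq> - \<Phi> ` \<gamma>" by (rule connected_component_subset)
    ultimately show False using fr by blast
  qed
  moreover have "bounded (\<Phi> ` inside \<gamma>)"
    by (rule bounded_subset[OF compact_imp_bounded[OF comp]]) (intro image_mono closure_subset)
  ultimately have "bounded ?C" using bounded_subset by blast
  then show ?thesis using \<open>\<Phi> z \<notin> \<Phi> ` \<gamma>\<close> unfolding inside_def by blast
qed

lemma conformal_image_loop:
  assumes D: "simply_connected_domain D" "simply_connected_domain D'" and \<Phi>: "conformal_map \<Phi> D D'"
    and \<gamma>: "\<gamma> \<in> self_avoiding_loops" "\<gamma> \<subseteq> D"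
  shows "\<Phi> ` \<gamma> \<in> self_avoiding_loops" "z \<in> D \<Longrightarrow> \<Phi> z \<in> inside (\<Phi> ` \<gamma>) \<longleftrightarrow> z \<in> inside \<gamma>"
proof -
  have hol: "\<Phi> holomorphic_on D" "inj_on \<Phi> D" "\<Phi> ` D = D'"
    using \<Phi> unfolding conformal_map_def bij_betw_def by auto
  show loop: "\<Phi> ` \<gamma> \<in> self_avoiding_loops"
  proof -
    obtain f where f: "parametrizes f \<gamma>" using \<gamma>(1) unfolding self_avoiding_loops_def by blast
    have fD: "f ` sphere 0 1 \<subseteq> D" using f \<gamma>(2) unfolding parametrizes_def by blast
    have "parametrizes (\<Phi> \<circ> f) (\<Phi> ` \<gamma>)"
      unfolding parametrizes_def
    proof (intro conjI)
      show "continuous_on (sphere 0 1) (\<Phi> \<circ> f)"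
        using f fD holomorphic_on_imp_continuous_on[OF hol(1)] unfolding parametrizes_def
        by (intro continuous_on_compose) (auto intro: continuous_on_subset)
      show "inj_on (\<Phi> \<circ> f) (sphere 0 1)"
        using f fD hol(2) unfolding parametrizes_def by (intro comp_inj_on) (auto intro: inj_on_subset)
      show "(\<Phi> \<circ> f) ` sphere 0 1 = \<Phi> ` \<gamma>" using f unfolding parametrizes_def by (auto simp: image_comp)
    qed
    then show ?thesis unfolding self_avoiding_loops_def by blast
  qed
  show "\<Phi> z \<in> inside (\<Phi> ` \<gamma>) \<longleftrightarrow> z \<in> inside \<gamma>" if "z \<in> D"
  proof
    show "\<Phi> z \<in> inside (\<Phi> ` \<gamma>)" if "z \<in> inside \<gamma>"
      by (rule conformal_image_inside[OF D(1) hol(1,2) \<gamma> that])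
    assume \<Phi>z: "\<Phi> z \<in> inside (\<Phi> ` \<gamma>)"
    have "open D" using D(1) unfolding simply_connected_domain_def by blast
    then obtain \<Psi> where \<Psi>: "conformal_map \<Psi> D' D" "\<And>z. z \<in> D \<Longrightarrow> \<Psi> (\<Phi> z) = z"
      using conformal_map_inverse[OF _ \<Phi>] by metis
    have "\<Psi> (\<Phi> z) \<in> inside (\<Psi> ` \<Phi> ` \<gamma>)"
      by (rule conformal_image_inside[OF D(2) _ _ loop _ \<Phi>z])
        (use \<Psi>(1) hol(3) \<gamma>(2) in \<open>auto simp: conformal_map_def bij_betw_def\<close>)
    moreover have "\<Psi> ` \<Phi> ` \<gamma> = \<gamma>" using \<Psi>(2) \<gamma>(2) by (force simp: image_iff)
    ultimately show "z \<in> inside \<gamma>" using \<Psi>(2) \<open>z \<in> D\<close> by simp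
  qed
qed

lemma simply_connected_domain_ball [simp]: "simply_connected_domain (ball z r)"
  unfolding simply_connected_domain_def by (simp add: convex_imp_simply_connected)

text \<open>On generators: the image of a loop in \<open>D\<close> encloses \<open>\<Phi> z\<close> if and only if the loop encloses \<open>z\<close>,
  and it encloses no point off \<open>D'\<close>.\<close>

lemma conformal_image_measurable:
  assumes \<mu>: "loop_measure \<mu>" and D: "simply_connected_domain D" "simply_connected_domain D'"
    and \<Phi>: "conformal_map \<Phi> D D'"
  shows "(\<lambda>\<gamma>. \<Phi> ` \<gamma>) \<in> restr_loops \<mu> D \<rightarrow>\<^sub>M restr_loops \<mu> D'"
proof -
  note sm = loop_measure_facts[OF \<mu>]
  have op: "open D" using D(1) unfolding simply_connected_domain_def by blast
  have \<Phi>D: "\<Phi> ` D = D'" using \<Phi> unfolding conformal_map_def bij_betw_def by auto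
  have sp: "space (restr_loops \<mu> D) = {\<gamma> \<in> self_avoiding_loops. \<gamma> \<subseteq> D}"
    unfolding restr_loops_def space_restrict_space sm(2) by blast
  have "{\<gamma> \<in> self_avoiding_loops. \<gamma> \<subseteq> D} \<in> sets \<mu>"
    unfolding sm(1) using loops_in_open_measurable[OF op] .
  moreover have "{\<gamma>. \<gamma> \<subseteq> D} \<inter> space \<mu> = {\<gamma> \<in> self_avoiding_loops. \<gamma> \<subseteq> D}" unfolding sm(2) by blast
  ultimately have inD: "{\<gamma>. \<gamma> \<subseteq> D} \<inter> space \<mu> \<in> sets \<mu>" by simp
  have im: "(\<lambda>\<gamma>. \<Phi> ` \<gamma>) \<in> space (restr_loops \<mu> D) \<rightarrow> self_avoiding_loops"
    unfolding sp using conformal_image_loop(1)[OF D \<Phi>] by blast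
  have "(\<lambda>\<gamma>. \<Phi> ` \<gamma>) \<in> restr_loops \<mu> D \<rightarrow>\<^sub>M \<mu>"
  proof (rule measurable_sigma_sets[OF sm(3) _ im])
    show "range (surrounding_loops UNIV) \<subseteq> Pow self_avoiding_loops"
      using surrounding_loops_subset by blast
    fix Y assume "Y \<in> range (surrounding_loops UNIV)"
    then obtain q where Y: "Y = surrounding_loops UNIV q" by blast
    show "(\<lambda>\<gamma>. \<Phi> ` \<gamma>) -` Y \<inter> space (restr_loops \<mu> D) \<in> sets (restr_loops \<mu> D)"
    proof (cases "q \<in> D'")
      case True
      then obtain z where z: "z \<in> D" "\<Phi> z = q" using \<Phi>D by blast
      have "(\<lambda>\<gamma>. \<Phi> ` \<gamma>) -` Y \<inter> space (restr_loops \<mu> D) = surrounding_loops D z"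
        unfolding sp Y surrounding_loops_def z(2)[symmetric]
        using conformal_image_loop[OF D \<Phi>] z(1) by blast
      moreover have "surrounding_loops D z \<in> sets (restr_loops \<mu> D)"
        unfolding restr_loops_def sets_restrict_space_iff[OF inD]
        using surrounding_loops_measurable[OF \<mu> op] by (auto simp: surrounding_loops_def)
      ultimately show ?thesis by simp
    next
      case False
      have "q \<notin> inside (\<Phi> ` \<gamma>)" if "\<gamma> \<subseteq> D" for \<gamma>
        using inside_subset_simply_connected[OF D(2), of "\<Phi> ` \<gamma>"] \<Phi>D that False by blast
      then have "(\<lambda>\<gamma>. \<Phi> ` \<gamma>) -` Y \<inter> space (restr_loops \<mu> D) = {}"
        unfolding sp Y surrounding_loops_def by blast
      then show ?thesis by simp
    qed
  qed
  moreover have "(\<lambda>\<gamma>. \<Phi> ` \<gamma>) \<in> space (restr_loops \<mu> D) \<rightarrow> {\<gamma>. \<gamma> \<subseteq> D'}"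
    unfolding sp using \<Phi>D by blast
  ultimately show ?thesis
    unfolding restr_loops_def[of \<mu> D'] by (intro measurable_restrict_space2)
qed

text \<open>Conformal restriction in the form used below. It is stated for differences because the events
  \<open>surrounding_loops V z\<close> with \<open>z \<in> V\<close> have infinite mass as soon as the measure is non-trivial.\<close>

lemma surrounding_loops_conformal_invariance:
  assumes \<mu>: "loop_measure \<mu>" "weak_conformal_restriction \<mu>"
    and D: "simply_connected_domain D" "simply_connected_domain D'" and \<Phi>: "conformal_map \<Phi> D D'"
    and V: "open V" "V \<subseteq> D" and W: "open W" "W \<subseteq> D" and z: "z \<in> D"
  shows "emeasure \<mu> (surrounding_loops (\<Phi> ` V) (\<Phi> z) - surrounding_loops (\<Phi> ` W) (\<Phi> z))
    = emeasure \<mu> (surrounding_loops V z - surrounding_loops W z)"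
proof -
  note sm = loop_measure_facts[OF \<mu>(1)]
  have hol: "\<Phi> holomorphic_on D" "inj_on \<Phi> D" "\<Phi> ` D = D'"
    using \<Phi> unfolding conformal_map_def bij_betw_def by auto
  have op: "open D" "open D'" using D unfolding simply_connected_domain_def by blast+
  have opV: "open (\<Phi> ` V)" "open (\<Phi> ` W)"
    using V W hol by (auto intro!: open_mapping_thm3 intro: holomorphic_on_subset inj_on_subset)
  let ?X = "surrounding_loops (\<Phi> ` V) (\<Phi> z) - surrounding_loops (\<Phi> ` W) (\<Phi> z)"
  let ?Y = "surrounding_loops V z - surrounding_loops W z"
  have X: "?X \<in> sets \<mu>" using surrounding_loops_measurable[OF \<mu>(1)] opV by blast
  have inD: "{\<gamma>. \<gamma> \<subseteq> U} \<inter> space \<mu> \<in> sets \<mu>" if "open U" for U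
  proof -
    have "{\<gamma>. \<gamma> \<subseteq> U} \<inter> space \<mu> = {\<gamma> \<in> self_avoiding_loops. \<gamma> \<subseteq> U}" unfolding sm(2) by blast
    then show ?thesis using loops_in_open_measurable[OF that] unfolding sm(1) by simp
  qed
  have XD: "?X \<subseteq> {\<gamma>. \<gamma> \<subseteq> D'}" using V hol(3) unfolding surrounding_loops_def by blast
  then have X': "?X \<in> sets (restr_loops \<mu> D')"
    unfolding restr_loops_def sets_restrict_space_iff[OF inD[OF op(2)]] using X by blast
  have sp: "space (restr_loops \<mu> D) = {\<gamma> \<in> self_avoiding_loops. \<gamma> \<subseteq> D}"
    unfolding restr_loops_def space_restrict_space sm(2) by blast
  have sub: "\<Phi> ` \<gamma> \<subseteq> \<Phi> ` U \<longleftrightarrow> \<gamma> \<subseteq> U" if "\<gamma> \<subseteq> D" "U \<subseteq> D" for \<gamma> U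
    using inj_on_image_subset_iff[OF hol(2) that] .
  have "\<Phi> ` \<gamma> \<in> ?X \<longleftrightarrow> \<gamma> \<in> ?Y" if "\<gamma> \<in> self_avoiding_loops" "\<gamma> \<subseteq> D" for \<gamma>
    using conformal_image_loop(1)[OF D \<Phi> that] conformal_image_loop(2)[OF D \<Phi> that z]
      sub[OF that(2) V(2)] sub[OF that(2) W(2)] that(1)
    unfolding surrounding_loops_def by simp
  moreover have "\<gamma> \<in> ?Y \<Longrightarrow> \<gamma> \<in> self_avoiding_loops \<and> \<gamma> \<subseteq> D" for \<gamma>
    using V(2) unfolding surrounding_loops_def by blast
  ultimately have "(\<lambda>\<gamma>. \<Phi> ` \<gamma>) -` ?X \<inter> space (restr_loops \<mu> D) = ?Y"
    unfolding sp by blast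
  moreover have "emeasure (restr_loops \<mu> D') ?X = emeasure \<mu> ?X"
    unfolding restr_loops_def using emeasure_restrict_space[OF inD[OF op(2)] XD] .
  moreover have "emeasure (restr_loops \<mu> D) ?Y = emeasure \<mu> ?Y"
    unfolding restr_loops_def 
    by (rule emeasure_restrict_space[OF inD[OF op(1)]]) (use V(2) in \<open>auto simp: surrounding_loops_def\<close>)
  moreover have "distr (restr_loops \<mu> D) (restr_loops \<mu> D') (\<lambda>\<gamma>. \<Phi> ` \<gamma>) = restr_loops \<mu> D'"
    using \<mu>(2) D \<Phi> unfolding weak_conformal_restriction_def by blast
  ultimately show ?thesis
    using emeasure_distr[OF conformal_image_measurable[OF \<mu>(1) D \<Phi>] X'] by simp
qed

section \<open>Loops in round shells\<close>

lemma surrounding_loops_mono: "D' \<subseteq> D \<Longrightarrow> surrounding_loops D' z \<subseteq> surrounding_loops D z"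
  unfolding surrounding_loops_def by blast

lemma emeasure_surrounding_loops_chain:
  assumes \<mu>: "loop_measure \<mu>" and D: "open D" "open D'" "open D''" "D'' \<subseteq> D'" "D' \<subseteq> D"
  shows "emeasure \<mu> (surrounding_loops D z - surrounding_loops D'' z)
    = emeasure \<mu> (surrounding_loops D z - surrounding_loops D' z)
      + emeasure \<mu> (surrounding_loops D' z - surrounding_loops D'' z)"
proof -
  note m = surrounding_loops_measurable[OF \<mu>]
  have "surrounding_loops D z - surrounding_loops D'' z
    = (surrounding_loops D z - surrounding_loops D' z) \<union> (surrounding_loops D' z - surrounding_loops D'' z)"
    using surrounding_loops_mono[OF D(4), of z] surrounding_loops_mono[OF D(5), of z] by blast
  also have "emeasure \<mu> \<dots> = emeasure \<mu> (surrounding_loops D z - surrounding_loops D' z)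
      + emeasure \<mu> (surrounding_loops D' z - surrounding_loops D'' z)"
    using m[OF D(1)] m[OF D(2)] m[OF D(3)] by (intro plus_emeasure[symmetric]) auto
  finally show ?thesis .
qed

lemma emeasure_surrounding_loops_mono:
  assumes \<mu>: "loop_measure \<mu>" and D: "open D" "open D'" "C \<subseteq> D" "D' \<subseteq> C'"
  shows "emeasure \<mu> (surrounding_loops C z - surrounding_loops C' z)
    \<le> emeasure \<mu> (surrounding_loops D z - surrounding_loops D' z)"
  using surrounding_loops_mono[OF D(3)] surrounding_loops_mono[OF D(4)]
    surrounding_loops_measurable[OF \<mu> D(1)] surrounding_loops_measurable[OF \<mu> D(2)]
  by (intro emeasure_mono) auto

text \<open>Cauchy's functional equation on the half-line: comparing \<open>real n * t\<close> with its integer part shows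
  that \<open>real n * \<bar>G t - t * G 1\<bar>\<close> stays bounded.\<close>

lemma additive_monotone_imp_linear:
  fixes G :: "real \<Rightarrow> real"
  assumes add: "\<And>s t. 0 \<le> s \<Longrightarrow> 0 \<le> t \<Longrightarrow> G (s + t) = G s + G t"
    and mono: "\<And>s t. 0 \<le> s \<Longrightarrow> s \<le> t \<Longrightarrow> G s \<le> G t"
    and t: "0 \<le> t"
  shows "G t = t * G 1"
proof (rule ccontr)
  assume "G t \<noteq> t * G 1"
  have G0: "G 0 = 0" using add[of 0 0] by simp
  have Gn: "G (of_nat n * s) = of_nat n * G s" if "0 \<le> s" for s and n :: nat
  proof (induction n)
    case 0
    then show ?case by (simp add: G0)
  next
    case (Suc n)
    have "G (of_nat (Suc n) * s) = G (of_nat n * s + s)" by (simp add: algebra_simps)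
    also have "\<dots> = G (of_nat n * s) + G s" using that by (intro add) auto
    finally show ?case using Suc by (simp add: algebra_simps)
  qed
  have G1: "0 \<le> G 1" using mono[of 0 1] G0 by simp
  have bound: "real n * \<bar>G t - t * G 1\<bar> \<le> G 1" for n :: nat
  proof -
    define k where "k = nat \<lfloor>real n * t\<rfloor>"
    have k: "real k \<le> real n * t" "real n * t \<le> real (Suc k)"
      using t real_of_int_floor_add_one_ge[of "real n * t"] unfolding k_def by (auto simp: add.commute)
    have "real k * G 1 \<le> real n * G t" "real n * G t \<le> real (Suc k) * G 1"
      using mono[OF _ k(1)] mono[OF _ k(2)] Gn[OF t, of n] Gn[of 1 k] Gn[of 1 "Suc k"] t by auto
    moreover have "real k * G 1 \<le> real n * t * G 1" "real n * t * G 1 \<le> real (Suc k) * G 1"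
      using k G1 by (intro mult_right_mono; simp)+
    ultimately have "\<bar>real n * G t - real n * t * G 1\<bar> \<le> G 1"
      by (simp add: abs_le_iff algebra_simps)
    moreover have "real n * (G t - t * G 1) = real n * G t - real n * t * G 1" by (simp add: algebra_simps)
    ultimately show ?thesis by (metis abs_mult abs_of_nat)
  qed
  have "0 < \<bar>G t - t * G 1\<bar>" using \<open>G t \<noteq> t * G 1\<close> by simp
  then obtain n :: nat where "G 1 < real n * \<bar>G t - t * G 1\<bar>" using ex_less_of_nat_mult by blast
  then show False using bound[of n] by simp
qed

definition shell_loops :: "complex \<Rightarrow> real \<Rightarrow> real \<Rightarrow> complex set set" where
  "shell_loops z r s = surrounding_loops (ball z s) z - surrounding_loops (ball z r) z"

lemma shell_loops_measurable: "loop_measure \<mu> \<Longrightarrow> shell_loops z r s \<in> sets \<mu>"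
  unfolding shell_loops_def using surrounding_loops_measurable by (meson open_ball sets.Diff)

text \<open>A loop keeps a positive distance from any point inside it, and some point of the dense set is
  inside.\<close>

lemma loops_covered_by_shells:
  "self_avoiding_loops = (\<Union>z\<in>dense_points. \<Union>n::nat. shell_loops z (1 / (real n + 1)) (real n + 1))"
proof (intro equalityI subsetI)
  fix \<gamma> assume \<gamma>: "\<gamma> \<in> self_avoiding_loops"
  note t = loop_topology[OF \<gamma>]
  obtain z where z: "z \<in> dense_points" "z \<in> inside \<gamma>" using dense_points(2)[OF t(3)] t(5) by blast
  obtain e where e: "e > 0" "ball z e \<subseteq> inside \<gamma>"
    using t(3) z(2) open_contains_ball by blast
  obtain b where b: "\<gamma> \<subseteq> ball z b"
    using compact_imp_bounded[OF t(1)] bounded_subset_ballD by blast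
  obtain n :: nat where n: "max (1 / e) b < n" using reals_Archimedean2 by blast
  then have "\<gamma> \<subseteq> ball z (real n + 1)" using b by auto
  moreover have "1 / e < real n + 1" using n by simp
  then have "1 / (real n + 1) < e" using e(1) by (simp add: field_simps)
  then have "ball z (1 / (real n + 1)) \<inter> \<gamma> = {}"
    using e(2) inside_no_overlap[of \<gamma>] subset_ball[of "1 / (real n + 1)" e z] by fastforce
  then have "\<not> \<gamma> \<subseteq> ball z (1 / (real n + 1))" using t(9) by blast
  ultimately have "\<gamma> \<in> shell_loops z (1 / (real n + 1)) (real n + 1)"
    using \<gamma> z(2) unfolding shell_loops_def surrounding_loops_def by (simp add: add.commute)
  then show "\<gamma> \<in> (\<Union>z\<in>dense_points. \<Union>n::nat. shell_loops z (1 / (real n + 1)) (real n + 1))"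
    using z(1) by (intro UN_I[of z] UN_I[of n] UNIV_I)
qed (auto simp: shell_loops_def surrounding_loops_def)

lemma shell_loops_scaling:
  assumes \<mu>: "loop_measure \<mu>" "weak_conformal_restriction \<mu>" and r: "0 < r"
  shows "emeasure \<mu> (shell_loops z (r * a) (r * b)) = emeasure \<mu> (shell_loops 0 a b)"
proof -
  define \<Phi> where "\<Phi> = (\<lambda>w. z + of_real r * w)"
  have "conformal_map \<Phi> UNIV UNIV"
    unfolding conformal_map_def \<Phi>_def
    by (intro conjI holomorphic_intros bij_betw_byWitness[where f' = "\<lambda>w. (w - z) / of_real r"])
      (use r in auto)
  moreover have "simply_connected_domain UNIV"
    unfolding simply_connected_domain_def by (simp add: convex_imp_simply_connected)
  moreover have "\<Phi> ` ball 0 x = ball z (r * x)" for x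
  proof -
    have "w \<in> \<Phi> ` ball 0 x" if "norm (w - z) < r * x" for w
      using r that unfolding \<Phi>_def
      by (intro image_eqI[where x = "(w - z) / of_real r"]) (auto simp: norm_divide field_simps)
    then show ?thesis using r unfolding \<Phi>_def
      by (auto simp: dist_norm norm_mult norm_minus_commute)
  qed
  moreover have "\<Phi> 0 = z" unfolding \<Phi>_def by simp
  ultimately show ?thesis
    using surrounding_loops_conformal_invariance[OF \<mu>, of UNIV UNIV \<Phi> "ball 0 b" "ball 0 a" 0]
    unfolding shell_loops_def by simp
qed

lemma radius_le_diameter:
  assumes "\<gamma> \<in> self_avoiding_loops" "a \<in> inside \<gamma>" "x \<in> \<gamma>"
  shows "dist a x \<le> diameter \<gamma>"
proof -
  have "bounded \<gamma>" using loop_topology(1)[OF assms(1)] compact_imp_bounded by blast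
  then have "\<gamma> \<subseteq> cball x (diameter \<gamma>)" using assms(3) diameter_bounded_bound by fastforce
  then have "- cball x (diameter \<gamma>) \<subseteq> outside \<gamma>" by (intro outside_subset_convex) auto
  then have "a \<in> cball x (diameter \<gamma>)" using assms(2) inside_Int_outside[of \<gamma>] by blast
  then show ?thesis by (simp add: dist_commute)
qed

text \<open>A loop around \<open>a\<close> that leaves the disc of radius \<open>\<delta>\<close> has diameter at least \<open>\<delta>\<close>, so the shell
  between the radii \<open>\<delta>\<close> and \<open>\<Delta>\<close> of nontriviality has finite mass.\<close>

lemma nontrivial_shell_finite:
  assumes \<mu>: "loop_measure \<mu>" "weak_conformal_restriction \<mu>" and nt: "nontrivial \<mu>"
  obtains x where "1 < x" "emeasure \<mu> (shell_loops 0 1 x) < \<infinity>"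
proof -
  obtain \<delta> \<Delta> a where d: "0 < \<delta>" "\<delta> < \<Delta>"
    "emeasure \<mu> {\<gamma> \<in> self_avoiding_loops. \<delta> \<le> diameter \<gamma> \<and> \<gamma> \<subseteq> ball a \<Delta>} \<notin> {0, \<infinity>}"
    using nt unfolding nontrivial_def by blast
  let ?T = "{\<gamma> \<in> self_avoiding_loops. \<delta> \<le> diameter \<gamma> \<and> \<gamma> \<subseteq> ball a \<Delta>}"
  have T: "?T \<in> sets \<mu>" using d(3) emeasure_notin_sets by blast
  have "shell_loops a \<delta> \<Delta> \<subseteq> ?T"
  proof
    fix \<gamma> assume "\<gamma> \<in> shell_loops a \<delta> \<Delta>"
    then have \<gamma>: "\<gamma> \<in> self_avoiding_loops" "\<gamma> \<subseteq> ball a \<Delta>" "a \<in> inside \<gamma>" "\<not> \<gamma> \<subseteq> ball a \<delta>"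
      unfolding shell_loops_def surrounding_loops_def by auto
    then obtain x where "x \<in> \<gamma>" "\<delta> \<le> dist a x" by (auto simp: subset_iff not_less)
    with radius_le_diameter[OF \<gamma>(1,3)] \<gamma> show "\<gamma> \<in> ?T" by force
  qed
  then have "emeasure \<mu> (shell_loops a \<delta> \<Delta>) \<le> emeasure \<mu> ?T" by (rule emeasure_mono[OF _ T])
  also have "\<dots> < \<infinity>" using d(3) by (simp add: less_top)
  finally have "emeasure \<mu> (shell_loops a (\<delta> * 1) (\<delta> * (\<Delta> / \<delta>))) < \<infinity>" using d(1) by simp
  then have "emeasure \<mu> (shell_loops 0 1 (\<Delta> / \<delta>)) < \<infinity>"
    unfolding shell_loops_scaling[OF \<mu> d(1)] .
  moreover have "1 < \<Delta> / \<delta>" using d by simp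
  ultimately show ?thesis using that by blast
qed

lemma nontrivial_imp_space_not_null:
  assumes \<mu>: "loop_measure \<mu>" and nt: "nontrivial \<mu>"
  shows "emeasure \<mu> self_avoiding_loops \<noteq> 0"
proof
  assume 0: "emeasure \<mu> self_avoiding_loops = 0"
  have "emeasure \<mu> X = 0" if "X \<subseteq> self_avoiding_loops" for X
    using emeasure_space[of \<mu> X] 0 loop_measure_facts(2)[OF \<mu>] by simp
  then show False using nt unfolding nontrivial_def by (metis (no_types, lifting) insertI1 mem_Collect_eq subsetI)
qed

text \<open>By scaling the mass depends only on the ratio of the radii, and it is additive along the chain
  \<open>1 \<le> x \<le> x * y\<close>; finiteness for one ratio \<open>x0 > 1\<close> spreads to the powers of \<open>x0\<close> and then, by
  monotonicity, to all ratios. A vanishing constant would make all shells, and hence all loops, null.\<close>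

proposition shell_mass:
  assumes \<mu>: "loop_measure \<mu>" "weak_conformal_restriction \<mu>" and nt: "nontrivial \<mu>"
  obtains c where "0 < c"
    "\<And>z r s. 0 < r \<Longrightarrow> r \<le> s \<Longrightarrow> emeasure \<mu> (shell_loops z r s) = ennreal (c * ln (s / r))"
proof -
  define M where "M x = emeasure \<mu> (shell_loops 0 1 x)" for x
  have M_mult: "M (x * y) = M x + M y" if "1 \<le> x" "1 \<le> y" for x y
  proof -
    have "x \<le> x * y" using that by (simp add: mult_le_cancel_left1)
    then have "M (x * y) = emeasure \<mu> (shell_loops 0 x (x * y)) + M x"
      unfolding M_def shell_loops_def
      by (intro emeasure_surrounding_loops_chain[OF \<mu>(1)] open_ball subset_ball that(1))
    also have "emeasure \<mu> (shell_loops 0 x (x * y)) = M y"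
      using shell_loops_scaling[OF \<mu>, of x 0 1 y] that unfolding M_def by simp
    finally show ?thesis by (simp add: add.commute)
  qed
  have M_mono: "M x \<le> M y" if "x \<le> y" for x y
    unfolding M_def shell_loops_def using that
    by (intro emeasure_surrounding_loops_mono[OF \<mu>(1)] open_ball subset_ball order_refl)
  obtain x0 where x0: "1 < x0" "M x0 < \<infinity>"
    using nontrivial_shell_finite[OF \<mu> nt] unfolding M_def by blast
  have M_finite: "M x < \<infinity>" for x
  proof -
    have "M (x0 ^ Suc n) < \<infinity>" for n
    proof (induction n)
      case (Suc n)
      have "M (x0 ^ Suc (Suc n)) = M x0 + M (x0 ^ Suc n)"
        unfolding power_Suc[of x0 "Suc n"] using x0(1) by (intro M_mult one_le_power) auto
      with Suc x0(2) show ?case by (simp add: less_top)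
    qed (use x0 in simp)
    moreover obtain n where "x < x0 ^ n" using real_arch_pow[OF x0(1)] by blast
    then have "x \<le> x0 ^ Suc n" using power_strict_increasing[OF _ x0(1), of n "Suc n"] by linarith
    ultimately show ?thesis using M_mono by (meson le_less_trans)
  qed
  define G where "G t = enn2real (M (exp t))" for t
  have M_eq: "M (exp t) = ennreal (G t)" for t
    unfolding G_def using M_finite[of "exp t"] by (simp add: less_top)
  have G: "G t = t * G 1" if "0 \<le> t" for t
  proof (rule additive_monotone_imp_linear[OF _ _ that])
    show "G (s + t) = G s + G t" if "0 \<le> s" "0 \<le> t" for s t
      using M_mult[of "exp s" "exp t"] that M_finite unfolding G_def 
      by (simp add: exp_add enn2real_plus less_top)
    show "G s \<le> G t" if "0 \<le> s" "s \<le> t" for s t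
      unfolding G_def using that M_mono M_finite by (intro enn2real_mono) (auto simp: less_top)
  qed
  have mass: "emeasure \<mu> (shell_loops z r s) = ennreal (G 1 * ln (s / r))" if "0 < r" "r \<le> s" for z r s
  proof -
    have "emeasure \<mu> (shell_loops z (r * 1) (r * (s / r))) = M (s / r)"
      unfolding M_def by (rule shell_loops_scaling[OF \<mu> that(1)])
    also have "\<dots> = M (exp (ln (s / r)))" using that by simp
    also have "\<dots> = ennreal (G 1 * ln (s / r))"
      unfolding M_eq using that G[of "ln (s / r)"] by (simp add: mult.commute)
    finally show ?thesis using that by simp
  qed
  have "0 \<le> G 1" unfolding G_def by simp
  moreover have "G 1 \<noteq> 0"
  proof
    assume 0: "G 1 = 0"
    have "1 / (real n + 1) \<le> real n + 1" for n :: nat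
      by (rule order_trans[of _ 1]) (auto simp: field_simps)
    then have "emeasure \<mu> (shell_loops z (1 / (real n + 1)) (real n + 1)) = 0" for z and n :: nat
      using mass[of "1 / (real n + 1)" "real n + 1" z] 0 by (simp add: add.commute)
    then have "self_avoiding_loops \<in> null_sets \<mu>"
      unfolding loops_covered_by_shells
      using shell_loops_measurable[OF \<mu>(1)] dense_points(1)
      by (intro null_sets_UN' null_setsI) auto
    then show False using nontrivial_imp_space_not_null[OF \<mu>(1) nt] by auto
  qed
  ultimately show ?thesis using that[of "G 1"] mass by simp
qed

section \<open>The conformal radius formula\<close>

lemma riemann_map_at:
  assumes D: "simply_connected_domain D" "D \<noteq> UNIV" and z: "z \<in> D"
  obtains g where "conformal_map g (ball 0 1) D" "g 0 = z"
proof -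
  obtain f g where fg: "g holomorphic_on ball 0 1"
    "\<forall>z\<in>D. f z \<in> ball 0 1 \<and> g (f z) = z" "\<forall>z\<in>ball 0 1. g z \<in> D \<and> f (g z) = z"
    using Riemann_mapping_theorem[of D] D z unfolding simply_connected_domain_def by blast
  have "f z \<in> ball 0 1" using fg(2) z by blast
  then obtain p q where pq: "p (f z) = 0" "q holomorphic_on ball 0 1"
    "p ` ball 0 1 \<subseteq> ball 0 1" "q ` ball 0 1 \<subseteq> ball 0 1"
    "\<And>w. w \<in> ball 0 1 \<Longrightarrow> p (q w) = w" "\<And>w. w \<in> ball 0 1 \<Longrightarrow> q (p w) = w"
    by (rule ball_biholomorphism_exists) blast
  have "q 0 = f z" using pq(1) pq(6)[OF \<open>f z \<in> ball 0 1\<close>] by simp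
  moreover have "conformal_map (g \<circ> q) (ball 0 1) D"
    unfolding conformal_map_def
  proof
    show "g \<circ> q holomorphic_on ball 0 1"
      by (rule holomorphic_on_compose_gen[OF pq(2) fg(1)]) (use pq(4) in auto)
    show "bij_betw (g \<circ> q) (ball 0 1) D"
      by (rule bij_betw_byWitness[where f' = "p \<circ> f"]) (use fg pq in \<open>auto simp: image_subset_iff\<close>)
  qed
  ultimately show ?thesis using that[of "g \<circ> q"] fg(2) z by simp
qed

lemma conformal_map_deriv_nonzero:
  assumes "open D" "conformal_map \<Phi> D D'" "z \<in> D"
  shows "deriv \<Phi> z \<noteq> 0"
  using conformal_map_inverse[OF assms(1,2)] assms(3) by (metis mult_zero_left zero_neq_one)

text \<open>Applied both to a Riemann map and to its inverse, this yields inclusions in both directions with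
  the same factor \<open>k\<close>.\<close>

lemma holomorphic_local_lipschitz:
  assumes "f holomorphic_on S" "open S" "w0 \<in> S" "deriv f w0 \<noteq> 0" "1 < k"
  obtains d where "0 < d" "\<And>w. norm (w - w0) < d \<Longrightarrow> norm (f w - f w0) \<le> k * norm (deriv f w0) * norm (w - w0)"
proof -
  let ?e = "(k - 1) * norm (deriv f w0)"
  have "(f has_derivative (*) (deriv f w0)) (at w0)"
    using holomorphic_derivI[OF assms(1-3)] unfolding has_field_derivative_def .
  moreover have "?e > 0" using assms by simp
  ultimately obtain d where d: "d > 0"
    "\<And>y. norm (y - w0) < d \<Longrightarrow> norm (f y - f w0 - deriv f w0 * (y - w0)) \<le> ?e * norm (y - w0)"
    unfolding has_derivative_at_alt by blast
  have "norm (f w - f w0) \<le> k * norm (deriv f w0) * norm (w - w0)" if "norm (w - w0) < d" for w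
  proof -
    have "norm (f w - f w0) \<le> norm (f w - f w0 - deriv f w0 * (w - w0)) + norm (deriv f w0 * (w - w0))"
      by (metis add.commute diff_add_cancel norm_triangle_ineq)
    also have "\<dots> \<le> ?e * norm (w - w0) + norm (deriv f w0) * norm (w - w0)"
      using d(2)[OF that] by (simp add: norm_mult)
    also have "\<dots> = k * norm (deriv f w0) * norm (w - w0)" by (simp add: algebra_simps)
    finally show ?thesis .
  qed
  with d(1) show ?thesis using that by blast
qed

text \<open>Near the centre a conformal map is almost a similarity of ratio \<open>norm (deriv g 0)\<close>. The upper
  inclusion comes from the inverse map, the lower one from \<open>g\<close>; the bound by \<open>1\<close> keeps the larger disc
  in the domain of \<open>g\<close>.\<close>

lemma small_disc_sandwich:
  assumes D: "simply_connected_domain D" and g: "conformal_map g (ball 0 1) D" "g 0 = z" and k: "1 < k"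
  obtains s0 where "0 < s0"
    "\<And>s. 0 < s \<Longrightarrow> s < s0 \<Longrightarrow> ball z s \<subseteq> D \<and> k * (s / norm (deriv g 0)) \<le> 1
        \<and> ball z s \<subseteq> g ` ball 0 (k * (s / norm (deriv g 0))) \<and> g ` ball 0 (s / (k * norm (deriv g 0))) \<subseteq> ball z s"
proof -
  let ?\<rho> = "norm (deriv g 0)"
  have op: "open D" using D unfolding simply_connected_domain_def by blast
  have \<rho>: "?\<rho> > 0" using conformal_map_deriv_nonzero[OF open_ball g(1)] by simp
  obtain h where h: "conformal_map h D (ball 0 1)" "\<And>u. u \<in> ball 0 1 \<Longrightarrow> h (g u) = u"
    "\<And>w. w \<in> D \<Longrightarrow> g (h w) = w" "\<And>u. u \<in> ball 0 1 \<Longrightarrow> deriv g u * deriv h (g u) = 1"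
    using conformal_map_inverse[OF open_ball g(1)] by metis
  have hz: "h z = 0" using h(2)[of 0] g(2) by simp
  have zD: "z \<in> D" using g unfolding conformal_map_def bij_betw_def by force
  have dh: "norm (deriv h z) = 1 / ?\<rho>"
    using h(4)[of 0] g(2) \<rho> by (metis centre_in_ball nonzero_eq_divide_eq norm_mult norm_one zero_less_one mult.commute less_numeral_extra(3))
  have "deriv h z \<noteq> 0" using conformal_map_deriv_nonzero[OF op h(1) zD] .
  with holomorphic_local_lipschitz[of h D z k] h(1) op zD k obtain d2 where d2: "0 < d2"
    "\<And>w. norm (w - z) < d2 \<Longrightarrow> norm (h w) \<le> k * (1 / ?\<rho>) * norm (w - z)"
    unfolding conformal_map_def dh hz by auto
  have "deriv g 0 \<noteq> 0" using \<rho> by auto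
  with holomorphic_local_lipschitz[of g "ball 0 1" 0 k] g k obtain d1 where d1: "0 < d1"
    "\<And>w. norm w < d1 \<Longrightarrow> norm (g w - z) \<le> k * ?\<rho> * norm w"
    unfolding conformal_map_def by auto
  obtain d3 where d3: "0 < d3" "ball z d3 \<subseteq> D" using op zD openE by blast
  let ?s0 = "Min {d2, d3, k * ?\<rho> * d1, ?\<rho> / k}"
  have "0 < ?s0" using d1 d2 d3 k \<rho> by simp
  moreover have "ball z s \<subseteq> D \<and> k * (s / ?\<rho>) \<le> 1
        \<and> ball z s \<subseteq> g ` ball 0 (k * (s / ?\<rho>)) \<and> g ` ball 0 (s / (k * ?\<rho>)) \<subseteq> ball z s"
    if "0 < s" "s < ?s0" for s
  proof (intro conjI)
    have s: "s < d2" "s < d3" "s < k * ?\<rho> * d1" "s < ?\<rho> / k" using that by auto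
    show sD: "ball z s \<subseteq> D" using d3(2) s(2) by auto
    show "k * (s / ?\<rho>) \<le> 1" using s(4) \<rho> k by (simp add: field_simps)
    show "ball z s \<subseteq> g ` ball 0 (k * (s / ?\<rho>))"
    proof
      fix w assume w: "w \<in> ball z s"
      then have ws: "norm (w - z) < s" by (simp add: dist_norm norm_minus_commute)
      have "norm (h w) \<le> k * (1 / ?\<rho>) * norm (w - z)" using d2(2) ws s(1) by simp
      also have "\<dots> < k * (1 / ?\<rho>) * s" using ws k \<rho> by (intro mult_strict_left_mono) auto
      finally have "h w \<in> ball 0 (k * (s / ?\<rho>))" by simp
      moreover have "g (h w) = w" using h(3) w sD by blast
      ultimately show "w \<in> g ` ball 0 (k * (s / ?\<rho>))" by force
    qed
    show "g ` ball 0 (s / (k * ?\<rho>)) \<subseteq> ball z s"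
    proof clarify
      fix u :: complex assume "u \<in> ball 0 (s / (k * ?\<rho>))"
      then have u: "norm u < s / (k * ?\<rho>)" by simp
      also have "\<dots> < d1" using s(3) k \<rho> by (simp add: field_simps)
      finally have "norm (g u - z) \<le> k * ?\<rho> * norm u" by (rule d1(2))
      also have "\<dots> < s" using u k \<rho> by (simp add: field_simps)
      finally show "g u \<in> ball z s" by (simp add: dist_norm norm_minus_commute)
    qed
  qed
  ultimately show ?thesis by (rule that)
qed

text \<open>The formula in terms of Riemann maps of both domains. As no map between the two domains occurs,
  it shows that the masses depend on the measure through \<open>c\<close> alone, which is what uniqueness needs.\<close>

definition conformal_radius_formula :: "complex set measure \<Rightarrow> real \<Rightarrow> bool" where
  "conformal_radius_formula \<mu> c \<longleftrightarrow> (\<forall>D' D z g' g.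
      simply_connected_domain D' \<and> simply_connected_domain D \<and> D' \<subseteq> D \<and>
      conformal_map g' (ball 0 1) D' \<and> g' 0 = z \<and> conformal_map g (ball 0 1) D \<and> g 0 = z \<longrightarrow>
      emeasure \<mu> (surrounding_loops D z - surrounding_loops D' z)
        = ennreal (c * ln (norm (deriv g 0) / norm (deriv g' 0))))"

context
  fixes \<mu> :: "complex set measure" and c :: real
  assumes \<mu>: "loop_measure \<mu>" "weak_conformal_restriction \<mu>" and c: "0 < c"
    and shell: "\<And>z r s. 0 < r \<Longrightarrow> r \<le> s \<Longrightarrow> emeasure \<mu> (shell_loops z r s) = ennreal (c * ln (s / r))"
begin

lemma emeasure_conformal_disc_shell:
  assumes D: "simply_connected_domain D" and g: "conformal_map g (ball 0 1) D" "g 0 = z" and t: "0 < t" "t \<le> 1"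
  shows "emeasure \<mu> (surrounding_loops D z - surrounding_loops (g ` ball 0 t) z) = ennreal (c * ln (1 / t))"
proof -
  have "g ` ball 0 1 = D" using g(1) unfolding conformal_map_def bij_betw_def by blast
  then show ?thesis
    using surrounding_loops_conformal_invariance[OF \<mu> simply_connected_domain_ball D g(1), of "ball 0 1" "ball 0 t" 0]
      shell[of t 1 0] t g(2) unfolding shell_loops_def by (simp add: subset_ball)
qed

text \<open>Monotonicity together with \<open>small_disc_sandwich\<close>, where the factor \<open>k\<close> is \<open>exp \<epsilon>\<close> so that it costs an
  additive error \<open>c * \<epsilon>\<close>.\<close>

lemma emeasure_minus_small_disc:
  assumes D: "simply_connected_domain D" and g: "conformal_map g (ball 0 1) D" "g 0 = z" and \<epsilon>: "0 < \<epsilon>"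
  obtains s0 where "0 < s0"
    "\<And>s. 0 < s \<Longrightarrow> s < s0 \<Longrightarrow> ball z s \<subseteq> D \<and>
      emeasure \<mu> (surrounding_loops D z - surrounding_loops (ball z s) z) < \<infinity> \<and>
      \<bar>measure \<mu> (surrounding_loops D z - surrounding_loops (ball z s) z) - c * ln (norm (deriv g 0) / s)\<bar> \<le> c * \<epsilon>"
proof -
  define k where "k = exp \<epsilon>"
  let ?\<rho> = "norm (deriv g 0)"
  have k: "1 < k" "ln k = \<epsilon>" using \<epsilon> unfolding k_def by auto
  have \<rho>: "?\<rho> > 0" using conformal_map_deriv_nonzero[OF open_ball g(1)] by simp
  have op: "open D" using D unfolding simply_connected_domain_def by blast
  have opg: "open (g ` ball 0 t)" if "t \<le> 1" for t
    using g(1) that unfolding conformal_map_def bij_betw_def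
    by (intro open_mapping_thm3) (auto intro: holomorphic_on_subset inj_on_subset)
  obtain s0 where s0: "0 < s0"
    "\<And>s. 0 < s \<Longrightarrow> s < s0 \<Longrightarrow> ball z s \<subseteq> D \<and> k * (s / ?\<rho>) \<le> 1
        \<and> ball z s \<subseteq> g ` ball 0 (k * (s / ?\<rho>)) \<and> g ` ball 0 (s / (k * ?\<rho>)) \<subseteq> ball z s"
    using small_disc_sandwich[OF D g k(1)] by blast
  have "ball z s \<subseteq> D \<and>
      emeasure \<mu> (surrounding_loops D z - surrounding_loops (ball z s) z) < \<infinity> \<and>
      \<bar>measure \<mu> (surrounding_loops D z - surrounding_loops (ball z s) z) - c * ln (?\<rho> / s)\<bar> \<le> c * \<epsilon>"
    if s: "0 < s" "s < s0" for s
  proof -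
    let ?m = "emeasure \<mu> (surrounding_loops D z - surrounding_loops (ball z s) z)"
    let ?a = "s / (k * ?\<rho>)" and ?b = "k * (s / ?\<rho>)"
    note sw = s0(2)[OF s]
    have ab: "0 < ?a" "0 < ?b" "?b \<le> 1" using s k \<rho> sw by auto
    have "?a \<le> ?b"
    proof -
      have "1 / k \<le> 1" "1 \<le> k" using k by auto
      then have "1 / k \<le> k" by linarith
      then have "(s / ?\<rho>) * (1 / k) \<le> (s / ?\<rho>) * k" using s \<rho> by (intro mult_left_mono) auto
      then show ?thesis by (simp add: mult.commute)
    qed
    with ab have a1: "?a \<le> 1" by simp
    have up: "?m \<le> ennreal (c * ln (1 / ?a))"
      unfolding emeasure_conformal_disc_shell[OF D g ab(1) a1, symmetric]
      using sw op opg[OF a1] by (intro emeasure_surrounding_loops_mono[OF \<mu>(1)]) auto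
    have low: "ennreal (c * ln (1 / ?b)) \<le> ?m"
      unfolding emeasure_conformal_disc_shell[OF D g ab(2,3), symmetric]
      using sw op by (intro emeasure_surrounding_loops_mono[OF \<mu>(1)]) auto
    have fin: "?m < \<infinity>" using up by (metis ennreal_less_top infinity_ennreal_def le_less_trans)
    have la: "ln (1 / ?a) = ln (?\<rho> / s) + \<epsilon>"
      using k s \<rho> by (simp add: ln_div ln_mult)
    have lb: "ln (1 / ?b) = ln (?\<rho> / s) - \<epsilon>"
      using k s \<rho> by (simp add: ln_div ln_mult)
    have "0 \<le> ln (1 / x)" if "0 < x" "x \<le> 1" for x :: real
      using that by (intro ln_ge_zero) simp
    note this[OF ab(2,3)] this[OF ab(1) a1]
    then have pos: "0 \<le> c * ln (1 / ?b)" "0 \<le> c * ln (1 / ?a)" using c by simp_all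
    have meq: "?m = ennreal (measure \<mu> (surrounding_loops D z - surrounding_loops (ball z s) z))"
      using fin by (simp add: emeasure_eq_ennreal_measure less_top)
    have "measure \<mu> (surrounding_loops D z - surrounding_loops (ball z s) z) \<le> c * ln (1 / ?a)"
      using up pos unfolding meq by simp
    moreover have "c * ln (1 / ?b) \<le> measure \<mu> (surrounding_loops D z - surrounding_loops (ball z s) z)"
      using low unfolding meq by simp
    ultimately have "\<bar>measure \<mu> (surrounding_loops D z - surrounding_loops (ball z s) z) - c * ln (?\<rho> / s)\<bar> \<le> c * \<epsilon>"
      unfolding la lb by (simp add: abs_le_iff algebra_simps)
    then show ?thesis using sw fin by blast
  qed
  with s0(1) show ?thesis by (rule that)
qed

text \<open>Both domains are compared with the same tiny disc around \<open>z\<close>, and its radius \<open>s\<close> cancels in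
  \<open>ln (\<rho> / s) - ln (\<rho>' / s)\<close>.\<close>

proposition emeasure_eq_ln_conformal_radius_ratio: "conformal_radius_formula \<mu> c"
  unfolding conformal_radius_formula_def
proof (intro allI impI, elim conjE)
  fix D' D z g' g
  assume D: "simply_connected_domain D'" "simply_connected_domain D" "D' \<subseteq> D"
    and g': "conformal_map g' (ball 0 1) D'" "g' 0 = z" and g: "conformal_map g (ball 0 1) D" "g 0 = z"
  let ?\<rho> = "norm (deriv g 0)" and ?\<rho>' = "norm (deriv g' 0)"
  let ?X = "surrounding_loops D z - surrounding_loops D' z"
  have \<rho>: "?\<rho> > 0" "?\<rho>' > 0"
    using conformal_map_deriv_nonzero[OF open_ball g(1)] conformal_map_deriv_nonzero[OF open_ball g'(1)] by simp_all
  have op: "open D" "open D'" using D unfolding simply_connected_domain_def by blast+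
  have approx: "emeasure \<mu> ?X < \<infinity> \<and> \<bar>measure \<mu> ?X - c * ln (?\<rho> / ?\<rho>')\<bar> \<le> 2 * c * \<epsilon>" if \<epsilon>: "0 < \<epsilon>" for \<epsilon>
  proof -
    obtain s1 where s1: "0 < s1"
      "\<And>s. 0 < s \<Longrightarrow> s < s1 \<Longrightarrow> ball z s \<subseteq> D \<and>
        emeasure \<mu> (surrounding_loops D z - surrounding_loops (ball z s) z) < \<infinity> \<and>
        \<bar>measure \<mu> (surrounding_loops D z - surrounding_loops (ball z s) z) - c * ln (?\<rho> / s)\<bar> \<le> c * \<epsilon>"
      using emeasure_minus_small_disc[OF D(2) g \<epsilon>] by blast
    obtain s2 where s2: "0 < s2"
      "\<And>s. 0 < s \<Longrightarrow> s < s2 \<Longrightarrow> ball z s \<subseteq> D' \<and>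
        emeasure \<mu> (surrounding_loops D' z - surrounding_loops (ball z s) z) < \<infinity> \<and>
        \<bar>measure \<mu> (surrounding_loops D' z - surrounding_loops (ball z s) z) - c * ln (?\<rho>' / s)\<bar> \<le> c * \<epsilon>"
      using emeasure_minus_small_disc[OF D(1) g' \<epsilon>] by blast
    define s where "s = min s1 s2 / 2"
    have s: "0 < s" "s < s1" "s < s2" using s1(1) s2(1) unfolding s_def by auto
    let ?Y = "surrounding_loops D z - surrounding_loops (ball z s) z"
    let ?Y' = "surrounding_loops D' z - surrounding_loops (ball z s) z"
    have sum: "emeasure \<mu> ?Y = emeasure \<mu> ?X + emeasure \<mu> ?Y'"
      using s2(2)[OF s(1,3)] op D(3) by (intro emeasure_surrounding_loops_chain[OF \<mu>(1)]) auto
    have fin: "emeasure \<mu> ?X < \<infinity>" "emeasure \<mu> ?Y' < \<infinity>" 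
      using sum s1(2)[OF s(1,2)] s2(2)[OF s(1,3)] by (auto simp: less_top)
    then have "measure \<mu> ?Y = measure \<mu> ?X + measure \<mu> ?Y'"
      unfolding measure_def sum by (simp add: enn2real_plus less_top)
    moreover have "c * ln (?\<rho> / s) - c * ln (?\<rho>' / s) = c * ln (?\<rho> / ?\<rho>')"
      using \<rho> s by (simp add: ln_div algebra_simps)
    ultimately have "\<bar>measure \<mu> ?X - c * ln (?\<rho> / ?\<rho>')\<bar> \<le> 2 * c * \<epsilon>"
      using s1(2)[OF s(1,2)] s2(2)[OF s(1,3)] by linarith
    with fin show ?thesis by blast
  qed
  have "measure \<mu> ?X = c * ln (?\<rho> / ?\<rho>')"
  proof (rule ccontr)
    assume ne: "measure \<mu> ?X \<noteq> c * ln (?\<rho> / ?\<rho>')"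
    define \<epsilon> where "\<epsilon> = \<bar>measure \<mu> ?X - c * ln (?\<rho> / ?\<rho>')\<bar> / (4 * c)"
    have "0 < \<epsilon>" using ne c unfolding \<epsilon>_def by simp
    from approx[OF this] have "\<bar>measure \<mu> ?X - c * ln (?\<rho> / ?\<rho>')\<bar> \<le> 2 * c * \<epsilon>" by blast
    then show False using ne c unfolding \<epsilon>_def by (simp add: field_simps)
  qed
  then show "emeasure \<mu> ?X = ennreal (c * ln (?\<rho> / ?\<rho>'))"
    using approx[of 1] by (simp add: emeasure_eq_ennreal_measure less_top)
qed

end

section \<open>The sigma-field on the loops of a shell\<close>

text \<open>The hypothesis says that \<open>U\<close> has no holes that a connected closed set could enclose. It passes to the
  component because such a set and its inside form a connected set.\<close>

lemma simply_connected_domain_component: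
  assumes U: "open U" and inside: "\<And>S. closed S \<Longrightarrow> connected S \<Longrightarrow> S \<subseteq> U \<Longrightarrow> inside S \<subseteq> U"
  shows "simply_connected_domain (connected_component_set U z)"
  unfolding simply_connected_domain_def
proof
  let ?C = "connected_component_set U z"
  show op: "open ?C" by (rule open_connected_component[OF U])
  have sub: "inside S \<subseteq> ?C" if S: "closed S" "connected S" "S \<subseteq> ?C" "S \<noteq> {}" for S
  proof -
    have "S \<subseteq> U" using S(3) connected_component_subset by blast
    then have "S \<union> inside S \<subseteq> U" using inside[OF S(1,2)] by blast
    moreover have "connected (S \<union> inside S)" by (rule connected_with_inside[OF S(1,2)])
    moreover obtain x where x: "x \<in> S" "x \<in> ?C" using S(3,4) by blast
    ultimately have "S \<union> inside S \<subseteq> connected_component_set U x"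
      by (intro connected_component_maximal) auto
    then show ?thesis using connected_component_eq[OF x(2)] by auto
  qed
  have "winding_number p w = 0" if p: "path p" "path_image p \<subseteq> ?C" "pathfinish p = pathstart p" "w \<notin> ?C" for p w
  proof -
    have "inside (path_image p) \<subseteq> ?C"
      using p by (intro sub) (auto simp: closed_path_image connected_path_image)
    then have "w \<in> outside (path_image p)" using p inside_Un_outside[of "path_image p"] by blast
    then show ?thesis using winding_number_zero_in_outside p by blast
  qed
  then show "simply_connected ?C"
    unfolding simply_connected_eq_winding_number_zero[OF op] using connected_connected_component by blast
qed

lemma surrounding_loops_component:
  assumes "\<And>S. closed S \<Longrightarrow> connected S \<Longrightarrow> S \<subseteq> U \<Longrightarrow> inside S \<subseteq> U"
  shows "surrounding_loops (connected_component_set U z) z = surrounding_loops U z"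
proof (intro equalityI subsetI)
  fix \<gamma> assume "\<gamma> \<in> surrounding_loops U z"
  then have \<gamma>: "\<gamma> \<in> self_avoiding_loops" "\<gamma> \<subseteq> U" "z \<in> inside \<gamma>" unfolding surrounding_loops_def by auto
  note t = loop_topology[OF \<gamma>(1)]
  have "connected (\<gamma> \<union> inside \<gamma>)" by (rule connected_with_inside[OF compact_imp_closed[OF t(1)] t(2)])
  moreover have "\<gamma> \<union> inside \<gamma> \<subseteq> U" using assms[OF compact_imp_closed[OF t(1)] t(2) \<gamma>(2)] \<gamma>(2) by blast
  ultimately have "\<gamma> \<union> inside \<gamma> \<subseteq> connected_component_set U z"
    using \<gamma>(3) by (intro connected_component_maximal) auto
  then show "\<gamma> \<in> surrounding_loops (connected_component_set U z) z"
    using \<gamma> unfolding surrounding_loops_def by blast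
next
  fix \<gamma> assume "\<gamma> \<in> surrounding_loops (connected_component_set U z) z"
  then show "\<gamma> \<in> surrounding_loops U z"
    using connected_component_subset[of U z] unfolding surrounding_loops_def by blast
qed

text \<open>For a fixed centre the events are closed under intersection: this is why the uniqueness argument
  keeps \<open>z\<close> fixed in each shell.\<close>

lemma surrounding_loops_Int:
  fixes z :: complex
  assumes D: "simply_connected_domain D1" "simply_connected_domain D2"
  defines "C \<equiv> connected_component_set (D1 \<inter> D2) z"
  shows "simply_connected_domain C" "surrounding_loops D1 z \<inter> surrounding_loops D2 z = surrounding_loops C z"
proof -
  have op: "open (D1 \<inter> D2)" using D unfolding simply_connected_domain_def by blast
  have ins: "inside S \<subseteq> D1 \<inter> D2" if "S \<subseteq> D1 \<inter> D2" for S
    using inside_subset_simply_connected[OF D(1)] inside_subset_simply_connected[OF D(2)] that by blast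
  show "simply_connected_domain C" unfolding C_def
    by (rule simply_connected_domain_component[OF op ins])
  have "surrounding_loops D1 z \<inter> surrounding_loops D2 z = surrounding_loops (D1 \<inter> D2) z"
    unfolding surrounding_loops_def by blast
  then show "surrounding_loops D1 z \<inter> surrounding_loops D2 z = surrounding_loops C z"
    unfolding C_def using surrounding_loops_component[OF ins] by simp
qed

definition discs_union :: "(complex \<times> nat) set \<Rightarrow> complex set" where
  "discs_union F = (\<Union>(p, n)\<in>F. cball p (1 / Suc n))"

lemma closed_discs_union: "finite F \<Longrightarrow> closed (discs_union F)"
  unfolding discs_union_def by (auto intro!: closed_UN)

text \<open>A disc cut along a finite union of small discs; \<open>slits z q\<close> lists the cuts that start at \<open>q\<close> and
  reach the boundary. The centres and radii range over countable sets, so there are countably many.\<close>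

definition slit_disc :: "complex \<Rightarrow> (complex \<times> nat) set \<times> nat \<Rightarrow> complex set" where
  "slit_disc z FN = connected_component_set (ball z (snd FN) - discs_union (fst FN)) z"

definition slits :: "complex \<Rightarrow> complex \<Rightarrow> ((complex \<times> nat) set \<times> nat) set" where
  "slits z q = {(F, N). finite F \<and> F \<subseteq> dense_points \<times> UNIV \<and> connected (discs_union F) \<and>
     q \<in> discs_union F \<and> \<not> discs_union F \<subseteq> ball z N}"

lemma countable_slits: "countable (slits z q)"
proof -
  have "countable {F. finite F \<and> F \<subseteq> dense_points \<times> (UNIV :: nat set)}"
    by (intro countable_Collect_finite_subset countable_SIGMA dense_points(1)) auto
  then have "countable ({F. finite F \<and> F \<subseteq> dense_points \<times> (UNIV :: nat set)} \<times> (UNIV :: nat set))"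
    by (intro countable_SIGMA) auto
  then show ?thesis by (rule countable_subset[rotated]) (auto simp: slits_def)
qed

lemma inside_avoids_slit:
  fixes S :: "complex set"
  assumes P: "connected P" "\<not> P \<subseteq> ball z r" and S: "S \<subseteq> ball z r - P"
  shows "inside S \<subseteq> ball z r - P"
proof -
  have out: "- ball z r \<subseteq> outside S" using S by (intro outside_subset_convex) auto
  then have "outside S \<inter> P \<noteq> {}" using P(2) by blast
  then have "inside S \<inter> P = {}"
    using inside_outside_intersect_connected[OF P(1), of S] S by blast
  then show ?thesis using out inside_Int_outside[of S] by blast
qed

lemma slit_disc:
  assumes "FN \<in> slits z q"
  shows "simply_connected_domain (slit_disc z FN)" "q \<notin> slit_disc z FN"
    "surrounding_loops (slit_disc z FN) z = surrounding_loops (ball z (snd FN) - discs_union (fst FN)) z"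
proof -
  obtain F N where FN: "FN = (F, N)" by fastforce
  have F: "finite F" "connected (discs_union F)" "q \<in> discs_union F" "\<not> discs_union F \<subseteq> ball z N"
    using assms unfolding FN slits_def by auto
  have op: "open (ball z N - discs_union F)" by (intro open_Diff closed_discs_union F open_ball)
  note ins = inside_avoids_slit[OF F(2,4)]
  show "simply_connected_domain (slit_disc z FN)"
    unfolding FN slit_disc_def fst_conv snd_conv by (rule simply_connected_domain_component[OF op ins])
  show "surrounding_loops (slit_disc z FN) z = surrounding_loops (ball z (snd FN) - discs_union (fst FN)) z"
    unfolding FN slit_disc_def fst_conv snd_conv by (rule surrounding_loops_component[OF ins])
  show "q \<notin> slit_disc z FN"
    using F(3) connected_component_subset[of "ball z N - discs_union F" z]
    unfolding FN slit_disc_def fst_conv snd_conv by blast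
qed

text \<open>The outside of a loop is connected and unbounded, so a path in it leads from \<open>q\<close> to the exterior of
  a large disc; the cut is a finite cover of this path by small discs in the outside.\<close>

lemma outside_point_slit:
  assumes \<gamma>: "\<gamma> \<in> self_avoiding_loops" "z \<in> inside \<gamma>" and q: "q \<in> outside \<gamma>"
  obtains FN where "FN \<in> slits z q" "\<gamma> \<in> surrounding_loops (slit_disc z FN) z"
proof -
  note t = loop_topology[OF \<gamma>(1)]
  obtain b where b: "\<gamma> \<subseteq> ball z b"
    using compact_imp_bounded[OF t(1)] bounded_subset_ballD by blast
  obtain N :: nat where N: "b < N" using reals_Archimedean2 by blast
  have \<gamma>N: "\<gamma> \<subseteq> ball z N" using b N by auto
  obtain w where w: "w \<in> outside \<gamma>" "w \<notin> ball z N"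
    using t(12) bounded_subset[OF bounded_ball, of "outside \<gamma>" z N] by blast
  have "path_connected (outside \<gamma>)" using connected_open_path_connected[OF t(4,7)] .
  then obtain p where p: "path p" "path_image p \<subseteq> outside \<gamma>" "pathstart p = q" "pathfinish p = w"
    using q w(1) unfolding path_connected_def by metis
  let ?T = "path_image p"
  let ?I = "{(a, n). a \<in> dense_points \<and> cball a (1 / real (Suc n)) \<subseteq> outside \<gamma> \<and> cball a (1 / real (Suc n)) \<inter> ?T \<noteq> {}}"
  have "\<exists>i\<in>?I. x \<in> ball (fst i) (1 / real (Suc (snd i)))" if x: "x \<in> ?T" for x
  proof -
    obtain e where e: "e > 0" "ball x e \<subseteq> outside \<gamma>" using t(4) p(2) x openE by blast
    obtain n where n: "1 / real (Suc n) < e / 2" using nat_approx_posE[of "e / 2"] e(1) by auto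
    obtain a where a: "a \<in> dense_points" "a \<in> ball x (1 / real (Suc n))"
      using dense_points(2)[of "ball x (1 / real (Suc n))" x] by auto
    have "cball a (1 / real (Suc n)) \<subseteq> ball x e"
    proof
      fix y assume "y \<in> cball a (1 / real (Suc n))"
      then have "dist x y < 1 / real (Suc n) + 1 / real (Suc n)"
        using a(2) dist_triangle[of x y a] by (simp add: dist_commute)
      then show "y \<in> ball x e" using n by simp
    qed
    moreover have "x \<in> ball a (1 / real (Suc n))" using a(2) by (simp add: dist_commute)
    moreover then have "cball a (1 / real (Suc n)) \<inter> ?T \<noteq> {}" 
      using x ball_subset_cball[of a "1 / real (Suc n)"] by blast
    ultimately show ?thesis using a(1) e(2) by (intro bexI[of _ "(a, n)"]) auto
  qed
  then have cover: "?T \<subseteq> (\<Union>i\<in>?I. ball (fst i) (1 / real (Suc (snd i))))" by blast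
  obtain F where F: "F \<subseteq> ?I" "finite F" "?T \<subseteq> (\<Union>i\<in>F. ball (fst i) (1 / real (Suc (snd i))))"
    by (rule compactE_image[OF compact_path_image[OF p(1)] _ cover]) auto
  have FI: "fst i \<in> dense_points" "cball (fst i) (1 / real (Suc (snd i))) \<subseteq> outside \<gamma>"
      "?T \<inter> cball (fst i) (1 / real (Suc (snd i))) \<noteq> {}" if "i \<in> F" for i
    using subsetD[OF F(1) that] by (simp_all add: case_prod_beta Int_commute)
  have TP: "?T \<subseteq> discs_union F"
  proof
    fix x assume "x \<in> ?T"
    then obtain i where i: "i \<in> F" "x \<in> ball (fst i) (1 / real (Suc (snd i)))" using F(3) by blast
    then have "x \<in> cball (fst i) (1 / real (Suc (snd i)))" using ball_subset_cball by blast
    then show "x \<in> discs_union F" using i(1) unfolding discs_union_def by force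
  qed
  have "F \<noteq> {}" using F(3) by auto
  have "discs_union F = (\<Union>i\<in>F. ?T \<union> cball (fst i) (1 / real (Suc (snd i))))"
    using TP \<open>F \<noteq> {}\<close> unfolding discs_union_def by (force simp: case_prod_beta)
  moreover have "connected (\<Union>i\<in>F. ?T \<union> cball (fst i) (1 / real (Suc (snd i))))"
  proof (rule connected_Union)
    fix A assume "A \<in> (\<lambda>i. ?T \<union> cball (fst i) (1 / real (Suc (snd i)))) ` F"
    then obtain i where i: "i \<in> F" "A = ?T \<union> cball (fst i) (1 / real (Suc (snd i)))" by blast
    then show "connected A"
      using p(1) FI(3)[OF i(1)] unfolding i(2) by (intro connected_Un connected_path_image convex_connected convex_cball)
  next
    have "q \<in> ?T" using p(3) pathstart_in_path_image by blast
    then show "\<Inter> ((\<lambda>i. ?T \<union> cball (fst i) (1 / real (Suc (snd i)))) ` F) \<noteq> {}" by blast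
  qed
  ultimately have "connected (discs_union F)" by simp
  moreover have "q \<in> discs_union F" "w \<in> discs_union F"
    using TP p(3,4) pathstart_in_path_image pathfinish_in_path_image by blast+
  moreover have "F \<subseteq> dense_points \<times> UNIV" using FI(1) by (simp add: subset_iff mem_Times_iff)
  ultimately have FN: "(F, N) \<in> slits z q" using F(2) w(2) unfolding slits_def by blast
  have "discs_union F \<subseteq> outside \<gamma>"
    unfolding discs_union_def case_prod_beta by (rule UN_least) (rule FI(2))
  then have "\<gamma> \<subseteq> ball z N - discs_union F" using \<gamma>N outside_no_overlap[of \<gamma>] by blast
  then have "\<gamma> \<in> surrounding_loops (slit_disc z (F, N)) z"
    unfolding slit_disc(3)[OF FN] using \<gamma> unfolding surrounding_loops_def by simp
  with FN show ?thesis by (rule that)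
qed

text \<open>Conversely, a loop in the slit disc has its inside in it as well, by simple connectedness, so the
  removed point \<open>q\<close> is outside.\<close>

lemma outside_event_eq:
  "{\<gamma> \<in> self_avoiding_loops. z \<in> inside \<gamma> \<and> q \<in> outside \<gamma>} = (\<Union>FN\<in>slits z q. surrounding_loops (slit_disc z FN) z)"
proof (intro equalityI subsetI)
  fix \<gamma> assume "\<gamma> \<in> {\<gamma> \<in> self_avoiding_loops. z \<in> inside \<gamma> \<and> q \<in> outside \<gamma>}"
  then show "\<gamma> \<in> (\<Union>FN\<in>slits z q. surrounding_loops (slit_disc z FN) z)"
    using outside_point_slit[of \<gamma> z q] by (metis (no_types, lifting) UN_I mem_Collect_eq)
next
  fix \<gamma> assume "\<gamma> \<in> (\<Union>FN\<in>slits z q. surrounding_loops (slit_disc z FN) z)"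
  then obtain FN where FN: "FN \<in> slits z q" "\<gamma> \<in> surrounding_loops (slit_disc z FN) z" by blast
  then have \<gamma>: "\<gamma> \<in> self_avoiding_loops" "\<gamma> \<subseteq> slit_disc z FN" "z \<in> inside \<gamma>"
    unfolding surrounding_loops_def by auto
  have "inside \<gamma> \<subseteq> slit_disc z FN" using inside_subset_simply_connected[OF slit_disc(1)[OF FN(1)] \<gamma>(2)] .
  then have "q \<in> outside \<gamma>"
    using slit_disc(2)[OF FN(1)] \<gamma>(2) inside_Un_outside[of \<gamma>] by blast
  with \<gamma> show "\<gamma> \<in> {\<gamma> \<in> self_avoiding_loops. z \<in> inside \<gamma> \<and> q \<in> outside \<gamma>}" by blast
qed

definition shell_events :: "complex \<Rightarrow> complex set set \<Rightarrow> complex set set set" where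
  "shell_events z S = {S \<inter> surrounding_loops V z | V. simply_connected_domain V \<and> z \<in> V}"

text \<open>By \<open>outside_event_eq\<close> the events that \<open>q\<close> is outside are countable unions of generators, and by
  \<open>in_inside_iff_dense_points\<close> these yield the events that \<open>q\<close> is inside.\<close>

lemma trace_sigma_shell:
  assumes S: "S = shell_loops z r s"
  shows "(\<inter>) S ` sets enclosure_space = sigma_sets S (shell_events z S)"
proof -
  have Sl: "S \<subseteq> self_avoiding_loops" "\<And>\<gamma>. \<gamma> \<in> S \<Longrightarrow> z \<in> inside \<gamma>"
    unfolding S shell_loops_def surrounding_loops_def by auto
  have \<mu>: "loop_measure loop_space" unfolding loop_measure_def by simp
  have Sm: "S \<in> sets enclosure_space"
    unfolding S using shell_loops_measurable[OF \<mu>] sets_loop_space by simp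
  define M where "M = sigma S (shell_events z S)"
  have ev: "shell_events z S \<subseteq> Pow S" unfolding shell_events_def by auto
  have M: "sets M = sigma_sets S (shell_events z S)" "space M = S"
    unfolding M_def using ev by (simp_all add: sets_measure_of space_measure_of_conv)
  have V: "S \<inter> surrounding_loops V z \<in> sets M" if "simply_connected_domain V" for V
  proof (cases "z \<in> V")
    case True
    then show ?thesis using that unfolding M shell_events_def by blast
  next
    case False
    have "\<not> z \<in> inside \<gamma>" if "\<gamma> \<subseteq> V" for \<gamma>
      using inside_subset_simply_connected[OF \<open>simply_connected_domain V\<close> that] False by blast
    then have "S \<inter> surrounding_loops V z = {}" unfolding surrounding_loops_def by blast
    then show ?thesis by simp
  qed
  have out: "{\<gamma> \<in> space M. q \<in> outside \<gamma>} \<in> sets M" for q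
  proof -
    have "{\<gamma> \<in> space M. q \<in> outside \<gamma>} = S \<inter> {\<gamma> \<in> self_avoiding_loops. z \<in> inside \<gamma> \<and> q \<in> outside \<gamma>}"
      using Sl unfolding M(2) by blast
    also have "\<dots> = (\<Union>FN\<in>slits z q. S \<inter> surrounding_loops (slit_disc z FN) z)"
      unfolding outside_event_eq by blast
    also have "\<dots> \<in> sets M"
      by (intro sets.countable_UN' countable_slits image_subsetI V slit_disc(1))
    finally show ?thesis .
  qed
  have pt: "S \<inter> surrounding_loops UNIV q \<in> sets M" for q
  proof -
    have "S \<inter> surrounding_loops UNIV q
        = {\<gamma> \<in> space M. \<exists>n. \<forall>x\<in>dense_points \<inter> ball q (1 / Suc n). \<not> x \<in> outside \<gamma>}"
      unfolding M(2) surrounding_loops_def using Sl(1) in_inside_iff_dense_points[of _ q] by blast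
    also have "\<dots> \<in> sets M"
      by (intro sets.sets_Collect_countable_Ex sets.sets_Collect_countable_All' sets.sets_Collect_neg out
          countable_Int1 dense_points(1))
    finally show ?thesis .
  qed
  have "(\<inter>) S ` sets enclosure_space = sigma_sets S ((\<inter>) S ` range (surrounding_loops UNIV))"
    unfolding sets_enclosure_space using Sm unfolding sets_enclosure_space
    by (rule sigma_sets_Int[OF _ Sl(1)])
  moreover have "sigma_sets S ((\<inter>) S ` range (surrounding_loops UNIV)) \<subseteq> sigma_sets S (shell_events z S)"
    using pt unfolding M(1) by (intro sigma_sets_subseteq sigma_sets_mono) auto
  moreover have "shell_events z S \<subseteq> (\<inter>) S ` sets enclosure_space"
  proof
    fix X assume "X \<in> shell_events z S"
    then obtain V where V: "simply_connected_domain V" "X = S \<inter> surrounding_loops V z"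
      unfolding shell_events_def by blast
    then have "surrounding_loops V z \<in> sets enclosure_space"
      using surrounding_loops_measurable[OF \<mu>] sets_loop_space unfolding simply_connected_domain_def by simp
    then show "X \<in> (\<inter>) S ` sets enclosure_space" using V(2) by blast
  qed
  then have "sigma_sets S (shell_events z S) \<subseteq> sigma_sets S ((\<inter>) S ` range (surrounding_loops UNIV))"
    unfolding calculation(1) by (intro sigma_sets_mono) simp
  ultimately show ?thesis by blast
qed

section \<open>Uniqueness and the formula for general domains\<close>

text \<open>The measurable subsets of the covering sets are closed under intersection and generate everything.\<close>

lemma measure_eqI_countable_cover:
  assumes sets: "sets M = sets N" and C: "countable C" "C \<subseteq> sets M" "\<Union>C = space M"
    and fin: "\<And>S. S \<in> C \<Longrightarrow> emeasure M S \<noteq> \<infinity>"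
    and eq: "\<And>S X. S \<in> C \<Longrightarrow> X \<in> sets M \<Longrightarrow> emeasure M (S \<inter> X) = emeasure N (S \<inter> X)"
  shows "M = N"
proof (rule measure_eqI_generator_eq_countable[where \<Omega> = "space M" and A = C
      and E = "{X \<in> sets M. \<exists>S\<in>C. X \<subseteq> S}"])
  let ?E = "{X \<in> sets M. \<exists>S\<in>C. X \<subseteq> S}"
  show "Int_stable ?E" unfolding Int_stable_def by blast
  show "?E \<subseteq> Pow (space M)" using sets.sets_into_space by blast
  show "emeasure M X = emeasure N X" if "X \<in> ?E" for X
  proof -
    obtain S where S: "S \<in> C" "X \<in> sets M" "X \<subseteq> S" using \<open>X \<in> ?E\<close> by blast
    then have "S \<inter> X = X" by blast
    with eq[OF S(1,2)] show ?thesis by simp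
  qed
  have "X \<in> sigma_sets (space M) ?E" if X: "X \<in> sets M" for X
  proof -
    have "X = (\<Union>S\<in>C. S \<inter> X)" using C(3) sets.sets_into_space[OF X] by blast
    also have "\<dots> \<in> sigma_sets (space M) ?E"
    proof (rule sigma_sets_UNION)
      show "countable ((\<lambda>S. S \<inter> X) ` C)" using C(1) by blast
      fix b assume "b \<in> (\<lambda>S. S \<inter> X) ` C"
      then show "b \<in> sigma_sets (space M) ?E" using X C(2) by (intro sigma_sets.Basic) auto
    qed
    finally show ?thesis .
  qed
  moreover have "sigma_sets (space M) ?E \<subseteq> sets M" by (intro sets.sigma_sets_subset) blast
  ultimately show "sets M = sigma_sets (space M) ?E" by blast
  then show "sets N = sigma_sets (space M) ?E" using sets by simp
qed (use C fin in auto)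

text \<open>Within the shell, the loops in \<open>V\<close> are those in the component of \<open>V \<inter> ball z s\<close> around \<open>z\<close> that
  leave the component of \<open>V \<inter> ball z r\<close>; the formula evaluates both measures on this difference.\<close>

lemma shell_mass_in_domain:
  assumes f: "conformal_radius_formula \<mu> c" "conformal_radius_formula \<nu> d" and c: "0 < c" "0 < d"
    and V: "simply_connected_domain V" "z \<in> V" and rs: "0 < r" "r \<le> s"
  shows "emeasure \<nu> (shell_loops z r s \<inter> surrounding_loops V z)
    = ennreal (d / c) * emeasure \<mu> (shell_loops z r s \<inter> surrounding_loops V z)"
    "emeasure \<mu> (shell_loops z r s \<inter> surrounding_loops V z) < \<infinity>"
proof -
  let ?C = "\<lambda>t. connected_component_set (V \<inter> ball z t) z"
  have C: "simply_connected_domain (?C t)" "surrounding_loops V z \<inter> surrounding_loops (ball z t) z = surrounding_loops (?C t) z" for t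
    using surrounding_loops_Int[OF V(1) simply_connected_domain_ball[of z t], of z] by auto
  have Csub: "?C t \<subseteq> ball z t" for t using connected_component_subset[of "V \<inter> ball z t" z] by blast
  have ne: "?C t \<noteq> UNIV" for t
    using bounded_subset[OF bounded_ball Csub] not_bounded_UNIV by metis
  have zC: "z \<in> ?C t" if "0 < t" for t using that V(2) by simp
  obtain g where g: "conformal_map g (ball 0 1) (?C s)" "g 0 = z"
    using riemann_map_at[OF C(1) ne zC[of s]] rs by auto
  obtain g' where g': "conformal_map g' (ball 0 1) (?C r)" "g' 0 = z"
    using riemann_map_at[OF C(1) ne zC[of r]] rs by auto
  have sub: "?C r \<subseteq> ?C s" using rs by (intro connected_component_mono) auto
  have eq: "shell_loops z r s \<inter> surrounding_loops V z = surrounding_loops (?C s) z - surrounding_loops (?C r) z"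
    unfolding C(2)[symmetric] shell_loops_def by blast
  let ?l = "ln (norm (deriv g 0) / norm (deriv g' 0))"
  have \<mu>: "emeasure \<mu> (shell_loops z r s \<inter> surrounding_loops V z) = ennreal (c * ?l)"
    and \<nu>: "emeasure \<nu> (shell_loops z r s \<inter> surrounding_loops V z) = ennreal (d * ?l)"
    unfolding eq using f C(1)[of r] C(1)[of s] sub g g' unfolding conformal_radius_formula_def by blast+
  have "ennreal (d * ?l) = ennreal (d / c * (c * ?l))" using c by simp
  also have "\<dots> = ennreal (d / c) * ennreal (c * ?l)" by (rule ennreal_mult') (use c in simp)
  finally show "emeasure \<nu> (shell_loops z r s \<inter> surrounding_loops V z)
    = ennreal (d / c) * emeasure \<mu> (shell_loops z r s \<inter> surrounding_loops V z)"
    unfolding \<mu> \<nu> .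
  show "emeasure \<mu> (shell_loops z r s \<inter> surrounding_loops V z) < \<infinity>" unfolding \<mu> by simp
qed

text \<open>Two finite measures that agree on an intersection-stable generator agree.\<close>

lemma shell_measures_eq:
  assumes \<mu>: "loop_measure \<mu>" "loop_measure \<nu>"
    and f: "conformal_radius_formula \<mu> c" "conformal_radius_formula \<nu> d" and c: "0 < c" "0 < d"
    and rs: "0 < r" "r \<le> s" and X: "X \<in> sets \<mu>"
  shows "emeasure \<nu> (shell_loops z r s \<inter> X) = ennreal (d / c) * emeasure \<mu> (shell_loops z r s \<inter> X)"
proof -
  let ?S = "shell_loops z r s"
  let ?M = "restrict_space (scale_measure (ennreal (d / c)) \<mu>) ?S" and ?N = "restrict_space \<nu> ?S"
  have S: "?S \<in> sets \<mu>" "?S \<in> sets \<nu>" "?S \<subseteq> space \<mu>" "?S \<subseteq> space \<nu>"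
    using shell_loops_measurable \<mu> sets.sets_into_space by blast+
  have SM: "?S \<inter> space (scale_measure (ennreal (d / c)) \<mu>) \<in> sets (scale_measure (ennreal (d / c)) \<mu>)"
    "?S \<inter> space \<nu> \<in> sets \<nu>"
    using S by (simp_all add: Int_absorb2 space_scale_measure)
  have val: "emeasure ?M Y = ennreal (d / c) * emeasure \<mu> Y" "emeasure ?N Y = emeasure \<nu> Y" if "Y \<subseteq> ?S" for Y
    using emeasure_restrict_space[OF SM(1) that] emeasure_restrict_space[OF SM(2) that] by simp_all
  have sets: "sets ?M = sigma_sets ?S (shell_events z ?S)" "sets ?N = sigma_sets ?S (shell_events z ?S)"
    unfolding sets_restrict_space sets_scale_measure loop_measure_facts(1)[OF \<mu>(1)] loop_measure_facts(1)[OF \<mu>(2)]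
    by (rule trace_sigma_shell[OF refl])+
  have "?M = ?N"
  proof (rule measure_eqI_generator_eq[where A = "\<lambda>_. ?S"])
    show "Int_stable (shell_events z ?S)"
      unfolding Int_stable_def
    proof (intro ballI)
      fix A B assume "A \<in> shell_events z ?S" "B \<in> shell_events z ?S"
      then obtain V W where VW: "simply_connected_domain V" "z \<in> V" "A = ?S \<inter> surrounding_loops V z"
        "simply_connected_domain W" "z \<in> W" "B = ?S \<inter> surrounding_loops W z"
        unfolding shell_events_def by blast
      have "A \<inter> B = ?S \<inter> surrounding_loops (connected_component_set (V \<inter> W) z) z"
        using surrounding_loops_Int(2)[OF VW(1,4), of z] VW(3,6) by blast
      moreover have "z \<in> connected_component_set (V \<inter> W) z" using VW(2,5) by simp
      ultimately show "A \<inter> B \<in> shell_events z ?S"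
        using surrounding_loops_Int(1)[OF VW(1,4), of z] unfolding shell_events_def by blast
    qed
    show "shell_events z ?S \<subseteq> Pow ?S" unfolding shell_events_def by blast
    show "emeasure ?M Y = emeasure ?N Y" if "Y \<in> shell_events z ?S" for Y
    proof -
      obtain V where V: "simply_connected_domain V" "z \<in> V" "Y = ?S \<inter> surrounding_loops V z"
        using \<open>Y \<in> shell_events z ?S\<close> unfolding shell_events_def by blast
      then have "Y \<subseteq> ?S" by blast
      show ?thesis
        unfolding val[OF \<open>Y \<subseteq> ?S\<close>] unfolding V(3)
        by (rule shell_mass_in_domain(1)[OF f c V(1,2) rs, symmetric])
    qed
    show "sets ?M = sigma_sets ?S (shell_events z ?S)" "sets ?N = sigma_sets ?S (shell_events z ?S)"
      by (rule sets)+
    have zs: "z \<in> ball z s" using rs by simp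
    \<comment> \<open>the shell itself is a generator, with \<open>V = ball z s\<close>\<close>
    have SV: "?S \<inter> surrounding_loops (ball z s) z = ?S" unfolding shell_loops_def by blast
    then show "range (\<lambda>_. ?S) \<subseteq> shell_events z ?S"
      using zs simply_connected_domain_ball unfolding shell_events_def by blast
    show "(\<Union>i::nat. ?S) = ?S" by simp
    have "emeasure \<mu> ?S < \<infinity>"
      using shell_mass_in_domain(2)[OF f c simply_connected_domain_ball zs rs] unfolding SV .
    then show "emeasure ?M ?S \<noteq> \<infinity>" unfolding val(1)[OF order_refl]
      by (simp add: ennreal_mult_eq_top_iff less_top)
  qed
  then show ?thesis using val[of "?S \<inter> X"] by simp
qed

lemma conformal_radius_formula_determines:
  assumes \<mu>: "loop_measure \<mu>" "loop_measure \<nu>"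
    and f: "conformal_radius_formula \<mu> c" "conformal_radius_formula \<nu> d" and c: "0 < c" "0 < d"
  shows "\<nu> = scale_measure (ennreal (d / c)) \<mu>"
proof -
  have rs: "0 < 1 / (real n + 1)" "1 / (real n + 1) \<le> real n + 1" for n :: nat
    by (simp, rule order_trans[of _ 1]) (auto simp: field_simps)
  define shells where "shells = (\<lambda>(z, n). shell_loops z (1 / (real n + 1)) (real n + 1)) ` (dense_points \<times> (UNIV :: nat set))"
  have "\<nu> = scale_measure (ennreal (d / c)) \<mu>"
  proof (rule measure_eqI_countable_cover[where C = shells])
    show "sets \<nu> = sets (scale_measure (ennreal (d / c)) \<mu>)"
      using loop_measure_facts(1)[OF \<mu>(1)] loop_measure_facts(1)[OF \<mu>(2)] by simp
    show "countable shells" unfolding shells_def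
      by (intro countable_image countable_SIGMA dense_points(1)) auto
    show "shells \<subseteq> sets \<nu>" unfolding shells_def using shell_loops_measurable[OF \<mu>(2)] by auto
    have "\<Union>shells = self_avoiding_loops"
      unfolding shells_def by (subst loops_covered_by_shells) auto
    then show "\<Union>shells = space \<nu>" using loop_measure_facts(2)[OF \<mu>(2)] by simp
    fix S assume "S \<in> shells"
    then obtain z n where S: "S = shell_loops z (1 / (real n + 1)) (real n + 1)" unfolding shells_def by auto
    show "emeasure \<nu> (S \<inter> X) = emeasure (scale_measure (ennreal (d / c)) \<mu>) (S \<inter> X)" if "X \<in> sets \<nu>" for X
      using shell_measures_eq[OF \<mu> f c rs] that loop_measure_facts(1)[OF \<mu>(1)] loop_measure_facts(1)[OF \<mu>(2)]
      unfolding S by simp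
    have z: "z \<in> ball z (real n + 1)" by simp
    have "S \<inter> surrounding_loops (ball z (real n + 1)) z = S" unfolding S shell_loops_def by blast
    then show "emeasure \<nu> S \<noteq> \<infinity>"
      using shell_mass_in_domain(2)[OF f(2) f(2) c(2) c(2) simply_connected_domain_ball z rs[of n]] unfolding S
      by simp
  qed
  then show ?thesis .
qed

text \<open>The inside of a loop in \<open>D\<close> stays in \<open>D\<close>, so the boundary of \<open>D\<close>, which is not empty, lies in the
  outside, and the outside is connected.\<close>

lemma disconnects_iff_inside:
  assumes D: "simply_connected_domain D" "D \<noteq> UNIV" "z \<in> D" and \<gamma>: "\<gamma> \<in> self_avoiding_loops" "\<gamma> \<subseteq> D"
  shows "disconnects \<gamma> z (frontier D) \<longleftrightarrow> z \<in> inside \<gamma>"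
proof
  note t = loop_topology[OF \<gamma>(1)]
  have I: "inside \<gamma> \<subseteq> D" using inside_subset_simply_connected[OF D(1) \<gamma>(2)] .
  have fr: "frontier D \<inter> D = {}"
    using D(1) frontier_disjoint_eq unfolding simply_connected_domain_def by blast
  show "z \<in> inside \<gamma>" if "disconnects \<gamma> z (frontier D)"
  proof (rule ccontr)
    assume "z \<notin> inside \<gamma>"
    then have "z \<in> outside \<gamma>" using that inside_Un_outside[of \<gamma>] unfolding disconnects_def by blast
    have "frontier D \<noteq> {}" using D(2,3) frontier_eq_empty by blast
    then obtain w where w: "w \<in> frontier D" by blast
    then have "w \<in> outside \<gamma>" using I fr \<gamma>(2) inside_Un_outside[of \<gamma>] by blast
    moreover have "outside \<gamma> \<subseteq> - \<gamma>" using outside_no_overlap[of \<gamma>] by blast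
    ultimately have "connected_component (- \<gamma>) z w"
      using t(7) \<open>z \<in> outside \<gamma>\<close> unfolding connected_component_def by blast
    then show False using that w unfolding disconnects_def by blast
  qed
  show "disconnects \<gamma> z (frontier D)" if z: "z \<in> inside \<gamma>"
    unfolding disconnects_def
  proof (intro conjI ballI notI)
    show False if "z \<in> \<gamma>" using that z inside_no_overlap[of \<gamma>] by blast
    show False if "w \<in> frontier D" "connected_component (- \<gamma>) z w" for w
      using inside_same_component[OF that(2) z] that(1) I fr by blast
  qed
qed

theorem proposition3:
  shows "(\<forall>\<mu> \<nu>.
            loop_measure \<mu> \<and> nontrivial \<mu> \<and> weak_conformal_restriction \<mu> \<and>
            loop_measure \<nu> \<and> nontrivial \<nu> \<and> weak_conformal_restriction \<nu> \<longrightarrow>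
            (\<exists>c::real. 0 < c \<and> \<nu> = scale_measure (ennreal c) \<mu>)) \<and>
         (\<forall>\<mu>. loop_measure \<mu> \<and> nontrivial \<mu> \<and> weak_conformal_restriction \<mu> \<longrightarrow>
            (\<exists>c::real. 0 < c \<and>
              (\<forall>D' D z \<Phi>.
                 simply_connected_domain D' \<and> simply_connected_domain D \<and>
                 D' \<subseteq> D \<and> D \<noteq> UNIV \<and> z \<in> D' \<and>
                 conformal_map \<Phi> D' D \<and> \<Phi> z = z \<and> deriv \<Phi> z \<in> \<real> \<and> 0 < Re (deriv \<Phi> z) \<longrightarrow>
                 emeasure \<mu> {\<gamma> \<in> self_avoiding_loops.
                               \<gamma> \<subseteq> D \<and> \<not> \<gamma> \<subseteq> D' \<and> disconnects \<gamma> z (frontier D)}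
                   = ennreal (c * ln (Re (deriv \<Phi> z))))))"
proof -
  have formula: "\<exists>c. 0 < c \<and> conformal_radius_formula \<mu> c"
    if "loop_measure \<mu>" "nontrivial \<mu>" "weak_conformal_restriction \<mu>" for \<mu>
    using shell_mass[OF that(1,3,2)] emeasure_eq_ln_conformal_radius_ratio[OF that(1,3)] by metis
  have mass: "emeasure \<mu> {\<gamma> \<in> self_avoiding_loops. \<gamma> \<subseteq> D \<and> \<not> \<gamma> \<subseteq> D' \<and> disconnects \<gamma> z (frontier D)}
      = ennreal (c * ln (Re (deriv \<Phi> z)))"
    if f: "conformal_radius_formula \<mu> c"
      and D: "simply_connected_domain D'" "simply_connected_domain D" "D' \<subseteq> D" "D \<noteq> UNIV" "z \<in> D'"
      and \<Phi>: "conformal_map \<Phi> D' D" "\<Phi> z = z" "deriv \<Phi> z \<in> \<real>" "0 < Re (deriv \<Phi> z)"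
    for \<mu> c D' D z \<Phi>
  proof -
    have op: "open D'" using D(1) unfolding simply_connected_domain_def by blast
    have "D' \<noteq> UNIV" using D(3,4) by blast
    then obtain g where g: "conformal_map g (ball 0 1) D'" "g 0 = z"
      using riemann_map_at[OF D(1) _ D(5)] by blast
    have gD: "g ` ball 0 1 = D'" using g(1) unfolding conformal_map_def bij_betw_def by blast
    \<comment> \<open>composing with \<open>\<Phi>\<close> gives a Riemann map of \<open>D\<close>, so \<open>\<Phi>' z\<close> is the ratio of the conformal radii\<close>
    have \<Phi>g: "conformal_map (\<Phi> \<circ> g) (ball 0 1) D" "(\<Phi> \<circ> g) 0 = z"
      using g \<Phi>(1,2) unfolding conformal_map_def
      by (auto simp: gD intro: holomorphic_on_compose bij_betw_trans)
    have "deriv (\<Phi> \<circ> g) 0 = deriv \<Phi> z * deriv g 0"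
      using g \<Phi>(1) op D(5) unfolding conformal_map_def
      by (subst deriv_chain) (auto intro: holomorphic_on_imp_differentiable_at)
    moreover have "norm (deriv \<Phi> z) = Re (deriv \<Phi> z)"
      using \<Phi>(3,4) by (auto elim!: Reals_cases)
    moreover have "deriv g 0 \<noteq> 0" using conformal_map_deriv_nonzero[OF open_ball g(1)] by simp
    ultimately have ratio: "norm (deriv (\<Phi> \<circ> g) 0) / norm (deriv g 0) = Re (deriv \<Phi> z)"
      by (simp add: norm_mult)
    have "{\<gamma> \<in> self_avoiding_loops. \<gamma> \<subseteq> D \<and> \<not> \<gamma> \<subseteq> D' \<and> disconnects \<gamma> z (frontier D)}
        = surrounding_loops D z - surrounding_loops D' z"
      using disconnects_iff_inside[OF D(2,4)] D(3,5) unfolding surrounding_loops_def by blast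
    then show ?thesis
      using f D(1-3) g \<Phi>g unfolding conformal_radius_formula_def ratio[symmetric] by (metis (no_types, lifting))
  qed
  have unique: "\<exists>k::real. 0 < k \<and> \<nu> = scale_measure (ennreal k) \<mu>"
    if \<mu>: "loop_measure \<mu>" "nontrivial \<mu>" "weak_conformal_restriction \<mu>"
      and \<nu>: "loop_measure \<nu>" "nontrivial \<nu>" "weak_conformal_restriction \<nu>" for \<mu> \<nu>
  proof -
    obtain c d where "0 < c" "conformal_radius_formula \<mu> c" "0 < d" "conformal_radius_formula \<nu> d"
      using formula[OF \<mu>] formula[OF \<nu>] by blast
    then show ?thesis
      using conformal_radius_formula_determines[OF \<mu>(1) \<nu>(1)] by (intro exI[of _ "d / c"]) simp
  qed
  show ?thesis
  proof (intro conjI allI impI)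
    fix \<mu> \<nu>
    assume "loop_measure \<mu> \<and> nontrivial \<mu> \<and> weak_conformal_restriction \<mu> \<and>
      loop_measure \<nu> \<and> nontrivial \<nu> \<and> weak_conformal_restriction \<nu>"
    then show "\<exists>k::real. 0 < k \<and> \<nu> = scale_measure (ennreal k) \<mu>" by (intro unique) auto
  next
    fix \<mu> assume "loop_measure \<mu> \<and> nontrivial \<mu> \<and> weak_conformal_restriction \<mu>"
    then obtain c where c: "0 < c" "conformal_radius_formula \<mu> c" using formula by blast
    show "\<exists>c::real. 0 < c \<and>
              (\<forall>D' D z \<Phi>.
                 simply_connected_domain D' \<and> simply_connected_domain D \<and>
                 D' \<subseteq> D \<and> D \<noteq> UNIV \<and> z \<in> D' \<and>
                 conformal_map \<Phi> D' D \<and> \<Phi> z = z \<and> deriv \<Phi> z \<in> \<real> \<and> 0 < Re (deriv \<Phi> z) \<longrightarrow>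
                 emeasure \<mu> {\<gamma> \<in> self_avoiding_loops.
                               \<gamma> \<subseteq> D \<and> \<not> \<gamma> \<subseteq> D' \<and> disconnects \<gamma> z (frontier D)}
                   = ennreal (c * ln (Re (deriv \<Phi> z))))"
      by (intro exI[of _ c] conjI allI impI c(1)) (elim conjE, rule mass[OF c(2)])
  qed
qed

end
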